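(* Let $m_0,m_1$ be positive integers. There exists $v_0\in\mathbb{R}$ such that for each solution $r$ of the $(m_0,m_1)$-BVP with initial velocity $\dot r(0)=v\geq v_0$, the Brouwer degree of the self-map $\psi_r$ of $\mathbb{S}^{m_0+m_1+1}$ is $\pm 1$.
   Context: For positive integers $m_0,m_1$, the $(m_0,m_1)$-ODE for a function $r:(0,\tfrac{\pi}{2})\to\mathbb{R}$ is $$\ddot r(t)=\left((m_1-m_0)\csc 2t-(m_0+m_1)\cot 2t\right)\dot r(t)-m_1\frac{\sin 2r(t)}{2\cos^2 t}+m_0\frac{\sin 2r(t)}{2\sin^2 t}.$$ A solution of the $(m_0,m_1)$-BVP is a solution $r$ of the $(m_0,m_1)$-ODE with $r(0)=0$ and $r(\tfrac{\pi}{2})=(2\ell+1)\tfrac{\pi}{2}$ for some $\ell\in\mathbb{Z}$, the boundary values being understood as limits as $t\to 0$ and $t\to\tfrac{\pi}{2}$. Its initial velocity is the derivative $\dot r(0)$ with respect to $t$ at $t=0$. For such $r$, the map $\psi_r:\mathbb{S}^{m_0+m_1+1}\to\mathbb{S}^{m_0+m_1+1}$ is, with $\mathbb{S}^{m_0+m_1+1}\subset\mathbb{R}^{m_0+1}\times\mathbb{R}^{m_1+1}$, $$\psi_r(x_1\sin t,\,x_2\cos t)=(x_1\sin r(t),\,x_2\cos r(t)),\qquad x_1\in\mathbb{S}^{m_0},\ x_2\in\mathbb{S}^{m_1},\ t\in[0,\tfrac{\pi}{2}].$$ The Brouwer degree of a solution $r$ of the $(m_0,m_1)$-BVP means the Brouwer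 degree of $\psi_r$. *)

theory Defs
  imports "HOL-Analysis.Analysis" "HOL-Homology.Homology"
begin

definition ode_rhs :: "nat \<Rightarrow> nat \<Rightarrow> real \<Rightarrow> real \<Rightarrow> real \<Rightarrow> real" where
  "ode_rhs m0 m1 t x v =
     ((real m1 - real m0) * inverse (sin (2 * t)) - (real m0 + real m1) * cot (2 * t)) * v
     - real m1 * (sin (2 * x) / (2 * (cos t)\<^sup>2))
     + real m0 * (sin (2 * x) / (2 * (sin t)\<^sup>2))"

definition ode_solution :: "nat \<Rightarrow> nat \<Rightarrow> (real \<Rightarrow> real) \<Rightarrow> bool" where
  "ode_solution m0 m1 r \<longleftrightarrow>
     (\<forall>t\<in>{0<..<pi/2}.
        (r has_real_derivative deriv r t) (at t) \<and>
        (deriv r has_real_derivative ode_rhs m0 m1 t (r t) (deriv r t)) (at t))"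

definition bvp_solution :: "nat \<Rightarrow> nat \<Rightarrow> (real \<Rightarrow> real) \<Rightarrow> bool" where
  "bvp_solution m0 m1 r \<longleftrightarrow>
     ode_solution m0 m1 r \<and>
     (r \<longlongrightarrow> 0) (at_right 0) \<and>
     (\<exists>l::int. (r \<longlongrightarrow> (2 * of_int l + 1) * (pi/2)) (at_left (pi/2)))"

(* Only the values of r on the open interval (0, pi/2) are meaningful; this is
   the extension to the closed interval by the boundary limits. *)
definition endpoint_ext :: "(real \<Rightarrow> real) \<Rightarrow> real \<Rightarrow> real" where
  "endpoint_ext r t =
     (if t \<le> 0 then Lim (at_right 0) r
      else if t \<ge> pi/2 then Lim (at_left (pi/2)) r
      else r t)"

definition has_initial_velocity :: "(real \<Rightarrow> real) \<Rightarrow> real \<Rightarrow> bool" where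
  "has_initial_velocity r v \<longleftrightarrow>
     (endpoint_ext r has_real_derivative v) (at 0 within {0..pi/2})"

(* The library's nsphere n is the unit sphere of R^(n+1), realised as sequences
   vanishing beyond index n.  The point (a x1, b x2) of R^(m0+1) x R^(m1+1) is the
   sequence with a x1 at the indices 0..m0, followed by b x2. *)
definition join_pt ::
  "nat \<Rightarrow> real \<Rightarrow> (nat \<Rightarrow> real) \<Rightarrow> real \<Rightarrow> (nat \<Rightarrow> real) \<Rightarrow> nat \<Rightarrow> real" where
  "join_pt m0 a x1 b x2 = (\<lambda>i. if i \<le> m0 then a * x1 i else b * x2 (i - Suc m0))"

definition psi :: "nat \<Rightarrow> nat \<Rightarrow> (real \<Rightarrow> real) \<Rightarrow> (nat \<Rightarrow> real) \<Rightarrow> (nat \<Rightarrow> real)" where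
  "psi m0 m1 r p =
     (THE q. \<exists>x1 \<in> topspace (nsphere m0). \<exists>x2 \<in> topspace (nsphere m1). \<exists>t\<in>{0..pi/2}.
        p = join_pt m0 (sin t) x1 (cos t) x2 \<and>
        q = join_pt m0 (sin (endpoint_ext r t)) x1 (cos (endpoint_ext r t)) x2)"

lemma topspace_nsphere_iff:
  "x \<in> topspace (nsphere n) \<longleftrightarrow> (\<Sum>i\<le>n. (x i)\<^sup>2) = 1 \<and> (\<forall>i>n. x i = 0)"
  by (simp add: nsphere)

lemma endpoint_ext_bvp:
  assumes "bvp_solution m0 m1 r"
  shows "endpoint_ext r 0 = 0" "cos (endpoint_ext r (pi/2)) = 0"
proof -
  show "endpoint_ext r 0 = 0"
    using assms by (auto simp: bvp_solution_def endpoint_ext_def intro!: tendsto_Lim)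
  obtain l :: int where l: "(r \<longlongrightarrow> (2 * of_int l + 1) * (pi/2)) (at_left (pi/2))"
    using assms by (auto simp: bvp_solution_def)
  have "Lim (at_left (pi/2)) r = (2 * of_int l + 1) * (pi/2)"
    by (rule tendsto_Lim[OF _ l]) simp
  then have "endpoint_ext r (pi/2) = of_int (2 * l + 1) * (pi/2)"
    using pi_gt_zero by (simp add: endpoint_ext_def del: pi_gt_zero)
  then show "cos (endpoint_ext r (pi/2)) = 0"
    unfolding cos_zero_iff_int by (intro exI[of _ "2 * l + 1"]) simp
qed

lemma psi_join_pt:
  assumes r: "bvp_solution m0 m1 r"
    and x1: "x1 \<in> topspace (nsphere m0)" and x2: "x2 \<in> topspace (nsphere m1)"
    and t: "t \<in> {0..pi/2}"
  shows "psi m0 m1 r (join_pt m0 (sin t) x1 (cos t) x2) =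
         join_pt m0 (sin (endpoint_ext r t)) x1 (cos (endpoint_ext r t)) x2"
  unfolding psi_def
proof (rule the_equality, goal_cases)
  case 1
  show ?case using x1 x2 t by blast
next
  case (2 q)
  then obtain y1 y2 s where y1: "y1 \<in> topspace (nsphere m0)" and y2: "y2 \<in> topspace (nsphere m1)"
    and s: "s \<in> {0..pi/2}"
    and p: "join_pt m0 (sin t) x1 (cos t) x2 = join_pt m0 (sin s) y1 (cos s) y2"
    and q: "q = join_pt m0 (sin (endpoint_ext r s)) y1 (cos (endpoint_ext r s)) y2"
    by blast
  have eq1: "sin t * x1 i = sin s * y1 i" if "i \<le> m0" for i
    using fun_cong[OF p, of i] that by (simp add: join_pt_def)
  have eq2: "cos t * x2 i = cos s * y2 i" for i
    using fun_cong[OF p, of "i + Suc m0"] by (simp add: join_pt_def)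
  have "(sin t)\<^sup>2 * (\<Sum>i\<le>m0. (x1 i)\<^sup>2) = (sin s)\<^sup>2 * (\<Sum>i\<le>m0. (y1 i)\<^sup>2)"
    unfolding sum_distrib_left power_mult_distrib[symmetric] by (rule sum.cong) (simp_all add: eq1)
  then have "(sin t)\<^sup>2 = (sin s)\<^sup>2"
    using x1 y1 by (simp add: topspace_nsphere_iff)
  moreover have "sin t \<ge> 0" "sin s \<ge> 0"
    using t s pi_gt_zero by (auto intro!: sin_ge_zero)
  ultimately have "sin t = sin s"
    by (metis power2_eq_imp_eq)
  then have ts: "t = s"
    using t s sin_inj_pi[of t s] by auto
  have 1: "sin (endpoint_ext r t) * x1 i = sin (endpoint_ext r t) * y1 i" if "i \<le> m0" for i
  proof (cases "t = 0")
    case True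
    then show ?thesis using endpoint_ext_bvp[OF r] by simp
  next
    case False
    then have "sin t > 0" using t by (intro sin_gt_zero) auto
    then show ?thesis using eq1[OF that] ts by simp
  qed
  have 2: "cos (endpoint_ext r t) * x2 i = cos (endpoint_ext r t) * y2 i" for i
  proof (cases "t = pi/2")
    case True
    show ?thesis unfolding True endpoint_ext_bvp(2)[OF r] by simp
  next
    case False
    then have "cos t > 0" using t by (intro cos_gt_zero_pi) auto
    then show ?thesis using eq2 ts by simp
  qed
  show ?case
    unfolding q ts[symmetric] by (auto simp: join_pt_def fun_eq_iff 1 2)
qed

end

theory Submission
  imports Defs
begin

text \<open>
  Over each great circle arc from \<open>x2\<close> to \<open>x1\<close> the map \<open>psi m0 m1 r\<close> is the planar curve
  \<open>(sin r(t), cos r(t))\<close>. As \<open>r\<close> runs from \<open>0\<close> to \<open>(2 l + 1) \<pi>/2\<close>, its homotopy class depends on the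
  integer \<open>l\<close> only, and \<open>l = 0\<close> gives the identity.

  If \<open>m0\<close> is odd, then \<open>x1\<close> has a perpendicular companion \<open>J x1\<close> depending continuously on \<open>x1\<close>, so
  the planar curve may move in the 2-sphere spanned by \<open>x1\<close>, \<open>J x1\<close> and \<open>x2\<close>. The only constraint
  is that it runs from the pole \<open>x2\<close> to the equator, and all such curves are homotopic. Hence \<open>psi\<close>
  is homotopic to the identity for every \<open>l\<close> (\<open>psi_homotopic_id\<close>). If \<open>m1\<close> is odd, the same argument
  with the two factors exchanged gives a homotopy to \<open>id\<close> or \<open>- id\<close> (\<open>psi_homotopic_sign\<close>), both of
  which are involutions and so have degree 1 or -1.

  If \<open>m0\<close> and \<open>m1\<close> are even, all the quarter turns of \<open>r\<close> contribute with the same sign, so \<open>psi\<close> has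
  degree \<open>2 l + 1\<close>, and the claim becomes that a large initial velocity forces \<open>l = 0\<close>. In the
  logarithmic time \<open>x = ln (tan t)\<close> the equation describes a pendulum \<open>h(x) = r(t)\<close> with variable
  coefficients,
  \<open>h'' = - damping * h' + stiffness * sin h * cos h\<close>.
  For \<open>x\<close> near \<open>-\<infinity>\<close> damping and stiffness are positive: the rest position \<open>h = 0\<close> is unstable, and
  \<open>h = \<pi>/2\<close> is the stable one. For \<open>x\<close> near \<open>+\<infinity>\<close> both are negative: \<open>h = \<pi>/2\<close> has become unstable,
  and friction feeds energy into the system. A solution with initial velocity \<open>v\<close> passes through the
  following stages.

  \<^item> By the time \<open>- ln v\<close> it has left the unstable position by a fixed angle, with so little speed that
    its energy lies definitely below the energy of that position (\<open>reaches_takeoff\<close>). It is trapped in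
    the well around \<open>\<pi>/2\<close>.
  \<^item> Until a fixed time \<open>b\<close> friction brings it to rest exponentially, at a rate independent of \<open>v\<close>
    (\<open>decay_to_equator\<close>). Since the time available is at least \<open>b + ln v\<close>, it is as close to
    \<open>(\<pi>/2, 0)\<close> in phase space as desired if \<open>v\<close> is large.
  \<^item> On a fixed time interval from \<open>b\<close> to \<open>X\<close> it stays close to \<open>(\<pi>/2, 0)\<close> by a Gronwall estimate.
  \<^item> After \<open>X\<close> the energy cannot decrease noticeably. To converge to another odd multiple of \<open>\<pi>/2\<close> the
    pendulum would have to swing through \<open>0\<close> or \<open>\<pi>\<close>, which makes it gain a fixed amount of energy. It
    would then rotate forever and not converge (\<open>late_no_escape\<close>). So the limit is \<open>\<pi>/2\<close>.
\<close>

section \<open>Comparison principles on the line\<close>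

text \<open>
  The value of \<open>(sin t)\<^sup>2\<close> at the logarithmic time \<open>x = ln (tan t)\<close>, see \<open>sin_arctan_exp\<close>.
\<close>
definition logistic :: "real \<Rightarrow> real" where
  "logistic x = exp (2 * x) / (1 + exp (2 * x))"

lemma logistic_pos: "0 < logistic x" and logistic_less_1: "logistic x < 1"
  by (simp_all add: logistic_def add_pos_pos)

lemma logistic_le_exp: "logistic x \<le> exp (2 * x)"
  by (simp add: logistic_def divide_le_eq add_pos_pos algebra_simps)

lemma logistic_has_derivative:
  "(logistic has_real_derivative 2 * logistic x * (1 - logistic x)) (at x)"
proof -
  have "1 + exp (2 * x) \<noteq> 0" by (smt (verit) exp_gt_zero)
  then show ?thesis
    unfolding logistic_def
    by (auto intro!: derivative_eq_intros simp: divide_simps power2_eq_square) (simp add: algebra_simps)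
qed

lemma one_minus_logistic: "1 - logistic x = logistic (- x)"
proof -
  have "1 + exp (2 * x) \<noteq> 0" "1 + exp (- (2 * x)) \<noteq> 0" by (smt (verit) exp_gt_zero)+
  then show ?thesis
    by (simp add: logistic_def divide_simps) (simp add: algebra_simps flip: exp_add)
qed

lemma logistic_mono: "x \<le> y \<Longrightarrow> logistic x \<le> logistic y"
  by (rule DERIV_nonneg_imp_nondecreasing[of x y logistic])
    (use logistic_has_derivative logistic_pos logistic_less_1 in
      \<open>force intro!: mult_nonneg_nonneg less_imp_le\<close>)+

lemma sin_cos_ge_cubic: "x - x ^ 3 \<le> sin x * cos x" if "0 \<le> x" for x :: real
proof -
  have "sin 0 * cos 0 - 0 + 0 ^ 3 \<le> sin x * cos x - x + x ^ 3"
  proof (rule DERIV_nonneg_imp_nondecreasing[OF that])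
    fix y :: real assume "0 \<le> y"
    have d: "((\<lambda>x. sin x * cos x - x + x ^ 3) has_real_derivative 3 * y\<^sup>2 - 2 * (sin y)\<^sup>2) (at y)"
      by (auto intro!: derivative_eq_intros simp: power2_eq_square[symmetric] cos_squared_eq)
    have "(sin y)\<^sup>2 \<le> y\<^sup>2" using abs_sin_x_le_abs_x[of y] by (simp flip: abs_le_square_iff)
    moreover have "0 \<le> y\<^sup>2" by simp
    ultimately have "0 \<le> 3 * y\<^sup>2 - 2 * (sin y)\<^sup>2" by linarith
    with d show "\<exists>d. ((\<lambda>x. sin x * cos x - x + x ^ 3) has_real_derivative d) (at y) \<and> d \<ge> 0"
      by blast
  qed
  then show ?thesis by simp
qed

text \<open>
  At points below \<open>b\<close> where \<open>q\<close> is positive it decreases, so going backwards from \<open>b\<close> it grows and can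
  never come down to zero. This turns differential inequalities that hold only where \<open>q\<close> is positive
  into lower bounds valid up to \<open>-\<infinity>\<close>.
\<close>
lemma barrier_backward:
  fixes q :: "real \<Rightarrow> real"
  assumes deriv: "\<And>x. x \<le> b \<Longrightarrow> (q has_real_derivative q' x) (at x)"
    and decr: "\<And>x. x \<le> b \<Longrightarrow> q x > 0 \<Longrightarrow> q' x \<le> 0"
    and pos: "q b > 0" and ab: "a \<le> b"
  shows "q b \<le> q a"
proof (rule ccontr)
  assume "\<not> q b \<le> q a"
  define m where "m = max (q a) 0"
  have m: "q a \<le> m" "m < q b" "0 \<le> m" using pos \<open>\<not> q b \<le> q a\<close> by (auto simp: m_def)
  have cont: "continuous_on {a..b} q"
    by (intro continuous_at_imp_continuous_on ballI DERIV_isCont[OF deriv]) auto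
  \<comment> \<open>The last point at which \<open>q\<close> does not exceed \<open>m\<close>: beyond it \<open>q\<close> is positive, hence decreasing.\<close>
  define A where "A = {x \<in> {a..b}. q x \<le> m}"
  have "closed A"
    unfolding A_def by (intro continuous_on_closed_Collect_le cont continuous_intros closed_atLeastAtMost)
  moreover have "bounded A"
    by (rule bounded_subset[OF bounded_closed_interval[of a b]]) (auto simp: A_def)
  ultimately have "compact A"
    by (simp add: compact_eq_bounded_closed)
  moreover have "a \<in> A" using ab m by (auto simp: A_def)
  ultimately obtain y where y: "y \<in> A" "\<And>z. z \<in> A \<Longrightarrow> z \<le> y"
    using compact_attains_sup[of A] by blast
  have "q b \<le> q y"
  proof (rule DERIV_nonpos_imp_decreasing_open[of y b])
    show "y \<le> b" using y by (auto simp: A_def)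
    show "\<exists>z. (q has_real_derivative z) (at x) \<and> z \<le> 0" if "y < x" "x < b" for x
    proof -
      have "x \<notin> A" using y(2)[of x] that by auto
      then have "q x > 0" using that y(1) m by (auto simp: A_def)
      then show ?thesis using deriv[of x] decr[of x] that by auto
    qed
    show "continuous_on {y..b} q"
      by (rule continuous_on_subset[OF cont]) (use y in \<open>auto simp: A_def\<close>)
  qed
  then show False using y m by (auto simp: A_def)
qed

lemma drift_not_convergent:
  fixes f :: "real \<Rightarrow> real"
  assumes deriv: "\<And>x. x \<ge> b \<Longrightarrow> (f has_real_derivative f' x) (at x)"
    and lower: "\<And>x. x \<ge> b \<Longrightarrow> f' x \<ge> c" and c: "c > 0"
  shows "\<not> (f \<longlongrightarrow> L) at_top"
proof
  assume "(f \<longlongrightarrow> L) at_top"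
  then have "eventually (\<lambda>x. f x < L + 1) at_top" by (rule order_tendstoD) simp
  moreover have "eventually (\<lambda>x. x \<ge> max b (b + (L + 1 - f b) / c)) at_top"
    by (rule eventually_ge_at_top)
  ultimately obtain x where fx: "f x < L + 1" and x: "x \<ge> max b (b + (L + 1 - f b) / c)"
    using eventually_happens'[OF _ eventually_conj] by (metis (no_types, lifting) trivial_limit_at_top_linorder)
  then have bx: "b \<le> x" and "(L + 1 - f b) / c \<le> x - b" by auto
  then have "L + 1 - f b \<le> c * (x - b)" using c by (simp add: divide_le_eq mult.commute)
  moreover have "f b - c * b \<le> f x - c * x"
  proof (rule DERIV_nonneg_imp_nondecreasing[OF bx])
    fix y assume "b \<le> y" "y \<le> x"
    then show "\<exists>d. ((\<lambda>x. f x - c * x) has_real_derivative d) (at y) \<and> d \<ge> 0"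
      using deriv[of y] lower[of y] by (intro exI[of _ "f' y - c"]) (auto intro!: derivative_eq_intros)
  qed
  ultimately show False using fx by (simp add: algebra_simps)
qed

lemma drift_not_convergent_bot:
  fixes f :: "real \<Rightarrow> real"
  assumes deriv: "\<And>x. x \<le> b \<Longrightarrow> (f has_real_derivative f' x) (at x)"
    and lower: "\<And>x. x \<le> b \<Longrightarrow> f' x \<ge> c" and c: "c > 0"
  shows "\<not> (f \<longlongrightarrow> L) at_bot"
proof
  assume "(f \<longlongrightarrow> L) at_bot"
  then have "((\<lambda>x. - f (- x)) \<longlongrightarrow> - L) at_top"
    by (intro tendsto_minus) (simp add: filterlim_at_bot_mirror)
  moreover have "((\<lambda>x. - f (- x)) has_real_derivative f' (- x)) (at x)" if "x \<ge> - b" for x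
  proof -
    have "(f has_real_derivative f' (- x)) (at (- x))" using deriv[of "-x"] that by simp
    then have "((\<lambda>x. f (- x)) has_real_derivative - f' (- x)) (at x)"
      by (simp add: DERIV_mirror)
    from DERIV_minus[OF this] show ?thesis by simp
  qed
  moreover have "f' (- x) \<ge> c" if "x \<ge> - b" for x using lower[of "-x"] that by simp
  ultimately show False using drift_not_convergent[of "-b" _ "\<lambda>x. f' (- x)" c "-L"] c by blast
qed

section \<open>The pendulum in logarithmic time\<close>

text \<open>
  \<open>M\<close> and \<open>N\<close> stand for the multiplicities \<open>m0\<close> and \<open>m1\<close>. The bound 2 makes the friction coefficient at
  least about 1 in absolute value, with opposite signs, at the two ends of the time axis.
\<close>
locale pendulum_parameters =
  fixes M N :: real
  assumes M: "2 \<le> M" and N: "2 \<le> N"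
begin

definition damping :: "real \<Rightarrow> real" where
  "damping x = (M - 1) - (M + N - 2) * logistic x"

definition stiffness :: "real \<Rightarrow> real" where
  "stiffness x = M - (M + N) * logistic x"

lemma stiffness_deriv:
  "(stiffness has_real_derivative - ((M + N) * (2 * logistic x * (1 - logistic x)))) (at x)"
  unfolding stiffness_def by (auto intro!: derivative_eq_intros logistic_has_derivative)

text \<open>
  The regime of friction and of a stable equator \<open>\<pi>/2\<close>. The remaining coefficients are within 1/10 of
  their limits at \<open>-\<infinity>\<close>.
\<close>
lemma early_bounds:
  assumes b: "(M + N) * exp (2 * b) \<le> 1/10" and x: "x \<le> b"
  shows "(M + N) * logistic x \<le> 1/10" "M - 11/10 \<le> damping x" "M - 1/10 \<le> stiffness x"
    and "damping x \<le> M - 1" "stiffness x \<le> M"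
proof -
  have "logistic x \<le> exp (2 * b)" using logistic_le_exp[of x] x
    by (meson exp_le_cancel_iff mult_le_cancel_left_pos order_trans zero_less_numeral)
  then have "(M + N) * logistic x \<le> (M + N) * exp (2 * b)" using M N by (intro mult_left_mono) auto
  then show *: "(M + N) * logistic x \<le> 1/10" using b by simp
  show "M - 11/10 \<le> damping x" "M - 1/10 \<le> stiffness x" "damping x \<le> M - 1" "stiffness x \<le> M"
    using * logistic_pos[of x] M N mult_nonneg_nonneg[of "M + N - 2" "logistic x"]
      mult_nonneg_nonneg[of "M + N" "logistic x"]
    by (simp_all add: damping_def stiffness_def algebra_simps)
qed

text \<open>
  The mirror image of the early regime, with friction and stiffness of the opposite sign.
\<close>
lemma late_bounds:
  assumes X: "(M + N) * (1 - logistic X) \<le> 1/10" and x: "X \<le> x"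
  shows "damping x \<le> - 9/10" "stiffness x \<le> - 19/10" "- N \<le> stiffness x"
proof -
  have "(M + N) * (1 - logistic x) \<le> (M + N) * (1 - logistic X)"
    using logistic_mono[OF x] M N by (intro mult_left_mono) auto
  with X have *: "(M + N) * (1 - logistic x) \<le> 1/10" by simp
  have "(M + N - 2) * (1 - logistic x) \<le> (M + N) * (1 - logistic x)" "0 \<le> (M + N) * (1 - logistic x)"
    using M N logistic_less_1[of x] by (auto intro!: mult_right_mono)
  then show "damping x \<le> - 9/10" "stiffness x \<le> - 19/10" "- N \<le> stiffness x"
    using * M N by (simp_all add: damping_def stiffness_def algebra_simps)
qed

text \<open>
  An angle, independent of \<open>v\<close>, that solutions of large initial velocity \<open>v\<close> have reached by the time
  \<open>- ln v\<close>.
  The factor \<open>M + 6/5\<close> converts a bound on \<open>g + M h\<close> into one on \<open>h\<close>, because \<open>g \<le> 6/5 h\<close>; the square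
  root is the loss caused by the nonlinearity.
\<close>
definition takeoff :: real where
  "takeoff = 1 / ((M + 6/5) * sqrt (1 + 4 * (M + N)))"

lemma takeoff_bounds: "0 < takeoff" "takeoff \<le> 1"
proof -
  have "1 \<le> sqrt (1 + 4 * (M + N))" using M N by simp
  then have "1 * 1 \<le> (M + 6/5) * sqrt (1 + 4 * (M + N))" using M by (intro mult_mono) auto
  then show "0 < takeoff" "takeoff \<le> 1"
    unfolding takeoff_def by (simp_all add: divide_le_eq)
qed

end

locale pendulum = pendulum_parameters +
  fixes h g :: "real \<Rightarrow> real"
  assumes h_deriv: "\<And>x. (h has_real_derivative g x) (at x)"
    and g_deriv: "\<And>x. (g has_real_derivative
          - damping x * g x + stiffness x * (sin (h x) * cos (h x))) (at x)"
begin

text \<open>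
  The potential is normalised to vanish at the equator \<open>h = \<pi>/2\<close>; at multiples of \<open>\<pi>\<close> it equals
  \<open>stiffness / 2\<close>, which is the depth of the well in the early regime.
\<close>
definition energy :: "real \<Rightarrow> real" where
  "energy x = ((g x)\<^sup>2 + stiffness x * (cos (h x))\<^sup>2) / 2"

lemma energy_deriv:
  "(energy has_real_derivative
     - damping x * (g x)\<^sup>2 - (M + N) * logistic x * (1 - logistic x) * (cos (h x))\<^sup>2) (at x)"
  unfolding energy_def
  by (auto intro!: derivative_eq_intros g_deriv h_deriv stiffness_deriv
      simp: field_simps power2_eq_square)

section \<open>Leaving the unstable rest position\<close>

text \<open>
  Gravity and friction both accelerate a solution of negative velocity towards larger angles. Hence its velocity was
  at least as negative in the past, and it could not have emerged from \<open>0\<close> at \<open>-\<infinity>\<close>.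
\<close>
lemma velocity_nonneg:
  assumes lim: "(h \<longlongrightarrow> 0) at_bot" and b: "(M + N) * exp (2 * b) \<le> 1/10"
    and angle: "\<And>x. x \<le> b \<Longrightarrow> 0 < h x \<and> h x \<le> 1"
  shows "0 \<le> g b"
proof (rule ccontr)
  assume neg: "\<not> 0 \<le> g b"
  have "- g b \<le> - g a" if "a \<le> b" for a
  proof (rule barrier_backward[where q = "\<lambda>x. - g x" and b = b])
    fix x assume x: "x \<le> b"
    show "((\<lambda>x. - g x) has_real_derivative
        - (- damping x * g x + stiffness x * (sin (h x) * cos (h x)))) (at x)"
      by (intro DERIV_minus g_deriv)
    assume "0 < - g x"
    moreover have "0 \<le> damping x" "0 \<le> stiffness x" using early_bounds[OF b x] M by auto
    moreover have "0 \<le> sin (h x)" "0 \<le> cos (h x)"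
      using angle[OF x] pi_gt3 by (auto intro!: sin_ge_zero cos_ge_zero)
    ultimately show "- (- damping x * g x + stiffness x * (sin (h x) * cos (h x))) \<le> 0"
      by (smt (verit) mult_nonneg_nonneg mult_minus_left mult_minus_right)
  qed (use neg that in auto)
  then have "\<not> ((\<lambda>x. - h x) \<longlongrightarrow> 0) at_bot"
    by (intro drift_not_convergent_bot[where b = b and f' = "\<lambda>x. - g x" and c = "- g b"])
      (use neg in \<open>auto intro!: DERIV_minus h_deriv\<close>)
  then show False using tendsto_minus[OF lim] by simp
qed

text \<open>
  A linearised solution has \<open>g = h\<close>. The region above \<open>g = c sin h\<close> is invariant in backward time as
  soon as \<open>c\<^sup>2 + (M - 1) c > M\<close>, that is \<open>c > 1\<close>, and a solution in it does not emerge from \<open>0\<close>. The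
  value 6/5 leaves room for the variation of the coefficients, and keeps \<open>c\<^sup>2 < 2 \<le> M\<close>, which is what makes
  the energy drop below the top of the potential in \<open>decay_to_equator\<close>.
\<close>
lemma velocity_upper:
  assumes lim: "(h \<longlongrightarrow> 0) at_bot" and b: "(M + N) * exp (2 * b) \<le> 1/10"
    and angle: "\<And>x. x \<le> b \<Longrightarrow> 0 < h x \<and> h x \<le> 1"
  shows "g b \<le> 6/5 * sin (h b)"
proof (rule ccontr)
  assume neg: "\<not> g b \<le> 6/5 * sin (h b)"
  define q where "q = (\<lambda>x. g x - 6/5 * sin (h x))"
  have sc: "0 \<le> sin (h x)" "0 \<le> cos (h x)" if "x \<le> b" for x
    using angle[OF that] pi_gt3 by (auto intro!: sin_ge_zero cos_ge_zero)
  have "q b \<le> q a" if "a \<le> b" for a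
  proof (rule barrier_backward[where q = q and b = b])
    fix x assume x: "x \<le> b"
    let ?q' = "- damping x * g x + stiffness x * (sin (h x) * cos (h x)) - 6/5 * (cos (h x) * g x)"
    show "(q has_real_derivative ?q') (at x)"
      unfolding q_def
      by (rule derivative_eq_intros refl g_deriv h_deriv)+ simp
    assume q: "0 < q x"
    have d: "M - 11/10 \<le> damping x" "stiffness x \<le> M" "M - 1/10 \<le> stiffness x"
      using early_bounds[OF b x] by auto
    have "(stiffness x - 36/25) * cos (h x) \<le> (stiffness x - 36/25) * 1"
      using d M by (intro mult_left_mono) auto
    also have "\<dots> \<le> M - 36/25" using d by simp
    finally have "(stiffness x - 36/25) * cos (h x) \<le> M - 36/25" .
    then have "- (6/5) * damping x + (stiffness x - 36/25) * cos (h x) \<le> 0" using d M by linarith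
    then have "sin (h x) * (- (6/5) * damping x + (stiffness x - 36/25) * cos (h x)) \<le> 0"
      using sc(1)[OF x] by (simp add: mult_le_0_iff)
    moreover have "0 \<le> (damping x + 6/5 * cos (h x)) * q x"
      using q d M sc(2)[OF x] by (intro mult_nonneg_nonneg) auto
    moreover have "?q' = - ((damping x + 6/5 * cos (h x)) * q x)
        + sin (h x) * (- (6/5) * damping x + (stiffness x - 36/25) * cos (h x))"
      by (simp add: q_def algebra_simps)
    ultimately show "?q' \<le> 0" by linarith
  qed (use neg that in \<open>auto simp: q_def\<close>)
  then have "g a \<ge> q b" if "a \<le> b" for a
    using sc[OF that] that by (force simp: q_def)
  then have "\<not> (h \<longlongrightarrow> 0) at_bot"
    by (intro drift_not_convergent_bot[where b = b and f' = g and c = "q b"])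
      (use neg in \<open>auto intro!: h_deriv simp: q_def\<close>)
  then show False using lim by simp
qed

text \<open>
  For the linearised equation with the coefficients at \<open>-\<infinity>\<close>, \<open>p = g + M h\<close> satisfies \<open>p' = p\<close>: it
  picks the growing mode out of the solutions \<open>e^x\<close> and \<open>e^(-M x)\<close>. The corrections are bounded by \<open>e^(2x) p\<close> and \<open>p^3\<close>
  times \<open>M + N\<close>, so \<open>p\<close> dominates a solution of a Bernoulli equation, which is linear in \<open>1 / p\<^sup>2\<close>. This gives
  a lower bound on \<open>p\<close> of order \<open>v e^x\<close> for \<open>e^x\<close> up to order \<open>1 / v\<close>.
\<close>
lemma small_angle_growth:
  assumes lim: "(h \<longlongrightarrow> 0) at_bot" and vel: "((\<lambda>x. h x * exp (- x)) \<longlongrightarrow> v) at_bot" and v: "0 < v"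
    and b: "(M + N) * exp (2 * b) \<le> 1/10"
    and angle: "\<And>x. x \<le> b \<Longrightarrow> 0 < h x \<and> h x \<le> 1"
  shows "1 + exp (2 * b) / (g b + M * h b)\<^sup>2 \<le> (1 + 1 / v\<^sup>2) * exp ((M + N) * exp (2 * b))"
proof -
  define C where "C = M + N"
  define p where "p = (\<lambda>x. g x + M * h x)"
  define p' where "p' = (\<lambda>x. - damping x * g x + stiffness x * (sin (h x) * cos (h x)) + M * g x)"
  define Q where "Q = (\<lambda>x. (1 + exp (2 * x) / (p x)\<^sup>2) * exp (- C * exp (2 * x)))"
  have bx: "(M + N) * exp (2 * x) \<le> 1/10" if "x \<le> b" for x
    using b that M N by (smt (verit) exp_le_cancel_iff mult_left_mono)
  have g0: "0 \<le> g x" if "x \<le> b" for x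
    by (rule velocity_nonneg[OF lim bx[OF that]]) (use angle that in auto)
  have ppos: "0 < p x" if "x \<le> b" for x
    using g0[OF that] angle[OF that] M by (simp add: p_def add_nonneg_pos)
  have pd: "(p has_real_derivative p' x) (at x)" for x
    unfolding p_def p'_def by (auto intro!: derivative_eq_intros g_deriv h_deriv)
  have p'_ge: "p' x \<ge> p x - C * (exp (2 * x) * p x + (p x) ^ 3)" if x: "x \<le> b" for x
  proof -
    have hx: "0 < h x" "h x \<le> 1" using angle[OF x] by auto
    have hp: "h x \<le> p x"
      using g0[OF x] hx M mult_right_mono[of 1 M "h x"] unfolding p_def by linarith
    have kap: "0 \<le> stiffness x" "stiffness x \<le> M" using early_bounds[OF b x] M by auto
    have "stiffness x * (h x - h x ^ 3) \<le> stiffness x * (sin (h x) * cos (h x))"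
      using kap sin_cos_ge_cubic[of "h x"] hx by (intro mult_left_mono) auto
    moreover have "stiffness x * h x ^ 3 \<le> C * p x ^ 3"
      using kap M N hx hp unfolding C_def by (intro mult_mono power_mono) auto
    moreover have "(M + N) * logistic x * h x \<le> C * (exp (2 * x) * p x)"
      unfolding C_def mult.assoc using M N hx hp logistic_le_exp[of x] logistic_pos[of x]
      by (intro mult_left_mono mult_mono) auto
    moreover have "stiffness x * h x = M * h x - (M + N) * logistic x * h x"
      by (simp add: stiffness_def algebra_simps)
    ultimately have "M * h x - C * (exp (2 * x) * p x + p x ^ 3)
        \<le> stiffness x * (sin (h x) * cos (h x))"
      by (simp add: algebra_simps)
    moreover have "1 * g x \<le> (M - damping x) * g x"
      using g0[OF x] early_bounds[OF b x] by (intro mult_right_mono) auto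
    ultimately show ?thesis by (simp add: p'_def p_def algebra_simps)
  qed
  have mono: "Q b \<le> Q y" if "y \<le> b" for y
  proof (rule DERIV_nonpos_imp_nonincreasing[OF that])
    fix x assume "y \<le> x" "x \<le> b"
    note x = \<open>x \<le> b\<close>
    let ?E = "exp (- C * exp (2 * x))"
    let ?d = "(2 * exp (2 * x) * (p x - p' x) / (p x) ^ 3 - 2 * C * exp (2 * x) * (1 + exp (2 * x) / (p x)\<^sup>2)) * ?E"
    have ne: "p x \<noteq> 0" using ppos[OF x] by simp
    have "((\<lambda>x. exp (2 * x) / (p x)\<^sup>2) has_real_derivative
        (2 * exp (2 * x) * (p x)\<^sup>2 - exp (2 * x) * (2 * p x * p' x)) / ((p x)\<^sup>2 * (p x)\<^sup>2)) (at x)"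
      by (rule derivative_eq_intros refl pd)+ (use ne in simp_all)
    also have "(2 * exp (2 * x) * (p x)\<^sup>2 - exp (2 * x) * (2 * p x * p' x)) / ((p x)\<^sup>2 * (p x)\<^sup>2)
        = 2 * exp (2 * x) * (p x - p' x) / (p x) ^ 3"
      using ne by (simp add: divide_simps) (simp add: algebra_simps power2_eq_square power3_eq_cube power4_eq_xxxx)
    finally have quot: "((\<lambda>x. exp (2 * x) / (p x)\<^sup>2) has_real_derivative
        2 * exp (2 * x) * (p x - p' x) / (p x) ^ 3) (at x)" .
    have "(Q has_real_derivative ?d) (at x)"
      unfolding Q_def
      by (rule derivative_eq_intros refl quot)+ (simp add: algebra_simps)
    moreover have "?d \<le> 0"
    proof -
      have "(p x - p' x) / (p x) ^ 3 \<le> C * (exp (2 * x) * p x + (p x) ^ 3) / (p x) ^ 3"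
        using p'_ge[OF x] ppos[OF x] by (intro divide_right_mono) auto
      also have "\<dots> = C * (1 + exp (2 * x) / (p x)\<^sup>2)"
        using ne by (simp add: field_simps power2_eq_square power3_eq_cube)
      finally have "2 * exp (2 * x) * ((p x - p' x) / (p x) ^ 3)
          \<le> 2 * exp (2 * x) * (C * (1 + exp (2 * x) / (p x)\<^sup>2))"
        by (intro mult_left_mono) auto
      then show ?thesis by (intro mult_nonpos_nonneg) (simp_all add: algebra_simps)
    qed
    ultimately show "\<exists>d. (Q has_real_derivative d) (at x) \<and> d \<le> 0" by blast
  qed
  \<comment> \<open>Near \<open>-\<infinity>\<close> the factor \<open>M \<ge> 2\<close> compensates the loss of the factor 2 in \<open>v / 2\<close>.\<close>
  have "eventually (\<lambda>y. v / 2 < h y * exp (- y)) at_bot"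
    using vel by (rule order_tendstoD) (use v in simp)
  then obtain y where y: "y \<le> b" "v / 2 < h y * exp (- y)"
    by (metis (no_types, lifting) eventually_at_bot_linorder linear order_refl)
  have "v * exp y \<le> 2 * h y"
    using y(2) by (simp add: exp_minus field_simps)
  also have "2 * h y \<le> p y"
    using g0[OF y(1)] angle[OF y(1)] M mult_right_mono[of 2 M "h y"] unfolding p_def by linarith
  finally have "(v * exp y)\<^sup>2 \<le> (p y)\<^sup>2" using v by (intro power_mono) auto
  then have "exp (2 * y) / (p y)\<^sup>2 \<le> 1 / v\<^sup>2"
    unfolding exp_double using ppos[OF y(1)] v by (simp add: field_simps power_mult_distrib)
  moreover have "0 \<le> C * exp (2 * y)" using M N by (simp add: C_def)
  ultimately have "Q y \<le> (1 + 1 / v\<^sup>2) * 1"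
    unfolding Q_def by (intro mult_mono) simp_all
  with mono[OF y(1)] have "Q b \<le> 1 + 1 / v\<^sup>2" by simp
  moreover have "Q b = (1 + exp (2 * b) / (p b)\<^sup>2) / exp (C * exp (2 * b))"
    by (simp add: Q_def exp_minus divide_inverse)
  ultimately show ?thesis
    by (simp add: pos_divide_le_eq p_def C_def)
qed

text \<open>
  If the angle stayed below \<open>takeoff\<close> until \<open>- ln v\<close>, then \<open>small_angle_growth\<close> would apply at that
  time, where \<open>e^x = 1 / v\<close>, and yield a value of \<open>g + M h\<close> that is too large for such an angle.
\<close>
lemma reaches_takeoff:
  assumes lim: "(h \<longlongrightarrow> 0) at_bot" and vel: "((\<lambda>x. h x * exp (- x)) \<longlongrightarrow> v) at_bot" and v: "0 < v"
    and b: "(M + N) * exp (2 * (- ln v)) \<le> 1/10"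
  shows "\<exists>x \<le> - ln v. h x = takeoff \<and> 0 \<le> g x \<and> g x \<le> 6/5 * sin takeoff"
proof -
  define xv where "xv = - ln v"
  \<comment> \<open>Angles \<open>\<le> 0\<close> are included so that outside \<open>A\<close> the velocity bounds apply; they are excluded a posteriori
     at the infimum of \<open>A\<close>, up to which \<open>h\<close> increases.\<close>
  define A where "A = {x. (h x \<le> 0 \<or> takeoff \<le> h x) \<and> x \<le> xv}"
  have bx: "(M + N) * exp (2 * x) \<le> 1/10" if "x \<le> xv" for x
    using b that M N unfolding xv_def by (smt (verit) exp_le_cancel_iff mult_left_mono)
  have hcont: "continuous_on UNIV h"
    by (intro continuous_at_imp_continuous_on ballI DERIV_isCont[OF h_deriv])
  have A: "A \<noteq> {}"
  proof
    assume "A = {}"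
    then have ang: "0 < h x" "h x < takeoff" if "x \<le> xv" for x using that by (auto simp: A_def not_le)
    then have angle: "0 < h x \<and> h x \<le> 1" if "x \<le> xv" for x
      using takeoff_bounds that by (meson less_le_trans less_imp_le)
    define z where "z = exp (2 * xv)"
    have z: "z = 1 / v\<^sup>2" "0 < z"
      using v by (simp_all add: z_def xv_def exp_minus exp_double divide_simps)
    define C where "C = M + N"
    have Cz: "C * z \<le> 1/10" "0 < C" "0 \<le> C * z" using bx[of xv] M N z by (auto simp: C_def z_def)
    have z1: "z \<le> 1" using Cz M N z mult_right_mono[of 1 C z] by (simp add: C_def)
    define p where "p = g xv + M * h xv"
    have g: "0 \<le> g xv" "g xv \<le> 6/5 * sin (h xv)"
      using velocity_nonneg[OF lim bx angle] velocity_upper[OF lim bx angle] by auto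
    have p: "0 < p" using g ang[of xv] M by (simp add: p_def add_nonneg_pos)
    have "1 + z / p\<^sup>2 \<le> (1 + z) * exp (C * z)"
      using small_angle_growth[OF lim vel v bx[OF order_refl] angle] z by (simp add: p_def C_def z_def)
    moreover have "exp (C * z) \<le> 1 + C * z + (C * z)\<^sup>2" using Cz by (intro exp_bound) auto
    moreover have "(C * z)\<^sup>2 \<le> (C * z) ^ 1" using Cz by (intro power_decreasing) auto
    ultimately have "1 + z / p\<^sup>2 \<le> (1 + z) * exp (C * z)" "exp (C * z) \<le> 1 + 2 * (C * z)" by auto
    moreover have "(1 + z) * exp (C * z) \<le> (1 + z) * (1 + 2 * (C * z))"
      using \<open>exp (C * z) \<le> 1 + 2 * (C * z)\<close> z(2) by (intro mult_left_mono) auto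
    ultimately have "1 + z / p\<^sup>2 \<le> (1 + z) * (1 + 2 * (C * z))" by linarith
    then have "z * (1 / p\<^sup>2) \<le> z * (1 + 2 * C + 2 * C * z)" by (simp add: algebra_simps)
    then have "1 / p\<^sup>2 \<le> 1 + 2 * C + 2 * C * z" using z(2) by (simp only: mult_le_cancel_left_pos)
    also have "\<dots> \<le> 1 + 4 * C" using z1 Cz by (simp add: mult_left_le)
    finally have "1 / (1 + 4 * C) \<le> p\<^sup>2" using p Cz by (simp add: field_simps)
    then have "sqrt (1 / (1 + 4 * C)) \<le> p" using p by (intro real_le_lsqrt) auto
    moreover have "p \<le> (M + 6/5) * h xv"
      using g ang[of xv] sin_x_le_x[of "h xv"] by (simp add: p_def algebra_simps)
    moreover have "(M + 6/5) * h xv < (M + 6/5) * takeoff"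
      using ang[of xv] M by simp
    moreover have "(M + 6/5) * takeoff = sqrt (1 / (1 + 4 * C))"
      using M by (simp add: takeoff_def C_def real_sqrt_divide)
    ultimately show False by linarith
  qed
  have "closed A"
    unfolding A_def Collect_conj_eq Collect_disj_eq
    by (intro closed_Int closed_Un closed_Collect_le continuous_intros hcont)
  have "eventually (\<lambda>x. h x < takeoff) at_bot"
    using lim by (rule order_tendstoD) (use takeoff_bounds in simp)
  moreover have "eventually (\<lambda>x. 0 < h x * exp (- x)) at_bot"
    using vel by (rule order_tendstoD) (use v in simp)
  ultimately have "eventually (\<lambda>x. 0 < h x \<and> h x < takeoff) at_bot"
    by eventually_elim (simp add: zero_less_mult_iff)
  then obtain B where B: "\<And>x. x \<le> B \<Longrightarrow> 0 < h x \<and> h x < takeoff"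
    by (auto simp: eventually_at_bot_linorder)
  have "B \<le> x" if "x \<in> A" for x
  proof (rule ccontr)
    assume "\<not> B \<le> x"
    then show False using B[of x] that unfolding A_def by auto
  qed
  then have "bdd_below A" by (rule bdd_belowI)
  define x1 where "x1 = Inf A"
  have x1: "x1 \<in> A" unfolding x1_def by (rule closed_contains_Inf[OF A \<open>bdd_below A\<close> \<open>closed A\<close>])
  have before: "0 < h x \<and> h x < takeoff" if "x < x1" for x
  proof -
    have "x \<notin> A"
    proof
      assume "x \<in> A"
      then have "x1 \<le> x" unfolding x1_def by (rule cInf_lower[OF _ \<open>bdd_below A\<close>])
      with that show False by simp
    qed
    then show ?thesis using that x1 by (auto simp: A_def)
  qed
  have gpos: "0 \<le> g x" if "x < x1" for x
  proof (rule velocity_nonneg[OF lim])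
    show "(M + N) * exp (2 * x) \<le> 1/10" using bx that x1 by (auto simp: A_def)
    show "0 < h y \<and> h y \<le> 1" if "y \<le> x" for y
      using before[of y] that \<open>x < x1\<close> takeoff_bounds by auto
  qed
  have "h (x1 - 1) \<le> h x1"
    by (rule DERIV_nonneg_imp_increasing_open[of "x1 - 1" x1 h])
      (use h_deriv gpos in \<open>auto intro!: continuous_on_subset[OF hcont]\<close>)
  then have h1: "0 < h x1" using before[of "x1 - 1"] by simp
  have "h x1 \<le> takeoff"
  proof (rule tendsto_upperbound)
    show "(h \<longlongrightarrow> h x1) (at_left x1)"
      using DERIV_isCont[OF h_deriv[of x1]] by (simp add: isCont_def filterlim_at_split)
    show "eventually (\<lambda>x. h x \<le> takeoff) (at_left x1)"
      by (intro eventually_at_leftI[of "x1 - 1"]) (use before in \<open>auto intro: less_imp_le\<close>)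
  qed simp
  then have h1': "h x1 = takeoff" using x1 h1 by (auto simp: A_def)
  have angle: "0 < h x \<and> h x \<le> 1" if "x \<le> x1" for x
    using before[of x] h1 h1' takeoff_bounds that by (cases "x = x1") auto
  have xv: "x1 \<le> xv" using x1 by (simp add: A_def)
  have "0 \<le> g x1" "g x1 \<le> 6/5 * sin (h x1)"
    using velocity_nonneg[OF lim bx[OF xv] angle] velocity_upper[OF lim bx[OF xv] angle] by auto
  then show ?thesis using h1' xv by (auto simp: xv_def)
qed

section \<open>Settling at the equator\<close>

lemma no_multiple_of_pi_crossing:
  assumes ab: "a \<le> b" and ha: "0 < h a" "h a < pi"
    and ne: "\<And>x. a \<le> x \<Longrightarrow> x \<le> b \<Longrightarrow> sin (h x) \<noteq> 0"
  shows "0 < h b \<and> h b < pi"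
proof (rule ccontr)
  assume neg: "\<not> (0 < h b \<and> h b < pi)"
  have hcont: "continuous_on {a..b} h"
    by (intro continuous_at_imp_continuous_on ballI DERIV_isCont[OF h_deriv])
  consider "h b \<le> 0" | "pi \<le> h b" using neg by linarith
  then have "\<exists>x. a \<le> x \<and> x \<le> b \<and> (h x = 0 \<or> h x = pi)"
    using IVT2'[of h b 0 a, OF _ _ ab hcont] IVT'[of h a pi b, OF _ _ ab hcont] ha by cases force+
  then obtain x where x: "a \<le> x" "x \<le> b" "h x = 0 \<or> h x = pi" by blast
  then show False using ne[of x] by auto
qed

text \<open>
  At the start, \<open>g\<^sup>2 \<le> 36/25 (sin \<theta>)\<^sup>2 < stiffness (sin \<theta>)\<^sup>2\<close> puts the energy below the top of the
  potential by a multiple of \<open>(sin \<theta>)\<^sup>2\<close>, and the time \<open>b\<close> is so early that the top is lowered by less than that until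
  \<open>b\<close>. So the pendulum keeps away from multiples of \<open>\<pi>\<close>. Friction alone does not give a rate, because it
  vanishes when \<open>g = 0\<close>; the cross term in \<open>L = energy - \<alpha> g sin h cos h\<close> makes \<open>L'\<close> negative definite
  away from the rest positions, and \<open>L\<close> is comparable to the energy.
\<close>
lemma decay_to_equator:
  assumes a: "h a = \<theta>" "0 \<le> g a" "g a \<le> 6/5 * sin \<theta>" and \<theta>: "0 < \<theta>" "\<theta> \<le> 1"
    and ab: "a \<le> b" and b: "(M + N) * exp (2 * b) \<le> (sin \<theta>)\<^sup>2 / 20"
  shows "(g b)\<^sup>2 + (cos (h b))\<^sup>2 \<le> 3 * M * exp (- ((sin \<theta>)\<^sup>2 / (40 * M\<^sup>2)) * (b - a))"
    and "0 < h b \<and> h b < pi"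
proof -
  define S where "S = (sin \<theta>)\<^sup>2"
  have S: "0 < S" "S \<le> 1"
    using \<theta> pi_gt3 sin_gt_zero[of \<theta>] by (auto simp: S_def abs_square_le_1)
  have early: "(M + N) * exp (2 * b) \<le> 1/10" using b S by (simp add: S_def)
  note eb = early_bounds[OF early]
  have CL: "(M + N) * logistic x \<le> S / 20" if "x \<le> b" for x
  proof -
    have "logistic x \<le> exp (2 * b)" using logistic_le_exp[of x] that
      by (meson exp_le_cancel_iff mult_le_cancel_left_pos order_trans zero_less_numeral)
    then have "(M + N) * logistic x \<le> (M + N) * exp (2 * b)" using M N by (intro mult_left_mono) auto
    then show ?thesis using b S_def by simp
  qed
  have E_deriv_le: "- damping x * (g x)\<^sup>2 - (M + N) * logistic x * (1 - logistic x) * (cos (h x))\<^sup>2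
      \<le> - damping x * (g x)\<^sup>2" for x
    using M N logistic_pos[of x] logistic_less_1[of x] by simp
  have E_mono: "energy x \<le> energy a" if "a \<le> x" "x \<le> b" for x
  proof (rule DERIV_nonpos_imp_nonincreasing[OF \<open>a \<le> x\<close>])
    fix y assume "a \<le> y" "y \<le> x"
    then have "0 \<le> damping y * (g y)\<^sup>2" using eb(2)[of y] M that by simp
    with E_deriv_le[of y] energy_deriv[of y]
    show "\<exists>d. (energy has_real_derivative d) (at y) \<and> d \<le> 0" by fastforce
  qed
  have Ea: "energy a \<le> M / 2 - 23/100 * S"
  proof -
    have "(g a)\<^sup>2 \<le> (6/5 * sin \<theta>)\<^sup>2" using a by (intro power_mono) auto
    then have "(g a)\<^sup>2 \<le> 36/25 * S" by (simp add: S_def power_mult_distrib power2_eq_square)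
    moreover have "(cos (h a))\<^sup>2 = 1 - S" by (simp add: S_def a cos_squared_eq)
    then have "energy a = ((g a)\<^sup>2 + (stiffness a - stiffness a * S)) / 2"
      by (simp only: energy_def right_diff_distrib mult_1_right)
    moreover have "19/10 * S \<le> stiffness a * S" using eb(3)[OF ab] M S by (intro mult_right_mono) auto
    ultimately show ?thesis using eb(5)[OF ab] by simp
  qed
  have gap: "energy x \<le> stiffness x / 2 - S / 5" if "a \<le> x" "x \<le> b" for x
    using E_mono[OF that] Ea CL[OF that(2)] S unfolding stiffness_def by argo
  have sin_gap: "2 * S / (5 * M) \<le> (sin (h x))\<^sup>2" if "a \<le> x" "x \<le> b" for x
  proof -
    have "stiffness x * (1 - (sin (h x))\<^sup>2) \<le> stiffness x - 2 * S / 5"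
      using gap[OF that] by (simp add: energy_def cos_squared_eq) (smt (verit) zero_le_power2)
    then have "2 * S / 5 \<le> stiffness x * (sin (h x))\<^sup>2" by (simp add: algebra_simps)
    also have "\<dots> \<le> M * (sin (h x))\<^sup>2" using eb[OF that(2)] by (intro mult_right_mono) auto
    finally show ?thesis using M by (simp add: field_simps)
  qed
  show "0 < h b \<and> h b < pi"
  proof (rule no_multiple_of_pi_crossing[OF ab])
    show "0 < h a" "h a < pi" using a \<theta> pi_gt3 by auto
    show "sin (h x) \<noteq> 0" if "a \<le> x" "x \<le> b" for x
    proof -
      have "0 < 2 * S / (5 * M)" using S M by simp
      then show ?thesis using sin_gap[OF that] by force
    qed
  qed
  \<comment> \<open>\<open>\<alpha>\<close> is small enough for friction to absorb the indefinite terms of \<open>L'\<close>; \<open>\<mu>\<close> is the resulting rate of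
     dissipation relative to the energy.\<close>
  define \<alpha> where "\<alpha> = 1 / (4 * M)"
  define \<mu> where "\<mu> = S / (20 * M\<^sup>2)"
  define w where "w = (\<lambda>x. sin (h x) * cos (h x))"
  define L where "L = (\<lambda>x. energy x - \<alpha> * (g x * w x))"
  define L' where "L' = (\<lambda>x. - damping x * (g x)\<^sup>2
      - (M + N) * logistic x * (1 - logistic x) * (cos (h x))\<^sup>2
      - \<alpha> * ((- damping x * g x + stiffness x * w x) * w x
             + (g x)\<^sup>2 * ((cos (h x))\<^sup>2 - (sin (h x))\<^sup>2)))"
  have Ld: "(L has_real_derivative L' x) (at x)" for x
    unfolding L_def L'_def w_def
    by (rule derivative_eq_intros refl energy_deriv g_deriv h_deriv)+
      (simp add: algebra_simps power2_eq_square)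
  have comparable: "7/8 * energy x \<le> L x" "L x \<le> 9/8 * energy x"
      "((g x)\<^sup>2 + (cos (h x))\<^sup>2) / 2 \<le> energy x" if "x \<le> b" for x
  proof -
    have "1 * (cos (h x))\<^sup>2 \<le> stiffness x * (cos (h x))\<^sup>2"
      using eb(3)[OF that] M by (intro mult_right_mono) auto
    then show 1: "((g x)\<^sup>2 + (cos (h x))\<^sup>2) / 2 \<le> energy x" by (simp add: energy_def)
    have "\<bar>w x\<bar> \<le> \<bar>cos (h x)\<bar>" unfolding w_def abs_mult
      using mult_right_mono[OF abs_sin_le_one[of "h x"], of "\<bar>cos (h x)\<bar>"] by simp
    then have "\<bar>g x * w x\<bar> \<le> \<bar>g x\<bar> * \<bar>cos (h x)\<bar>" unfolding abs_mult by (intro mult_left_mono) auto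
    also have "\<dots> \<le> ((g x)\<^sup>2 + (cos (h x))\<^sup>2) / 2"
      using sum_squares_bound[of "\<bar>g x\<bar>" "\<bar>cos (h x)\<bar>"] by simp
    finally have 2: "\<bar>g x * w x\<bar> \<le> energy x" using 1 by linarith
    have "\<alpha> * \<bar>g x * w x\<bar> \<le> 1/8 * energy x"
      using 2 M by (intro mult_mono) (auto simp: \<alpha>_def field_simps)
    moreover have "\<bar>\<alpha> * (g x * w x)\<bar> = \<alpha> * \<bar>g x * w x\<bar>" using M by (simp add: abs_mult \<alpha>_def)
    ultimately show "7/8 * energy x \<le> L x" "L x \<le> 9/8 * energy x"
      unfolding L_def by linarith+
  qed
  have L'_le: "L' x \<le> - \<mu> * energy x" if x: "a \<le> x" "x \<le> b" for x
  proof -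
    have "damping x * \<bar>g x * w x\<bar> \<le> M * ((g x)\<^sup>2 + (w x)\<^sup>2 / 4)"
    proof (intro mult_mono)
      show "\<bar>g x * w x\<bar> \<le> (g x)\<^sup>2 + (w x)\<^sup>2 / 4"
        using sum_squares_bound[of "\<bar>g x\<bar>" "\<bar>w x\<bar> / 2"] by (simp add: abs_mult power_divide)
    qed (use eb(4)[OF x(2)] M in auto)
    moreover have "damping x * (g x * w x) \<le> damping x * \<bar>g x * w x\<bar>"
      using eb(2)[OF x(2)] M by (intro mult_left_mono) auto
    ultimately have 1: "\<alpha> * (damping x * (g x * w x)) \<le> \<alpha> * (M * ((g x)\<^sup>2 + (w x)\<^sup>2 / 4))"
      using M by (intro mult_left_mono) (auto simp: \<alpha>_def)
    have 2: "\<alpha> * ((M - 1/10) * (w x)\<^sup>2) \<le> \<alpha> * (stiffness x * (w x)\<^sup>2)"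
      using eb(3)[OF x(2)] M by (intro mult_left_mono mult_right_mono) (auto simp: \<alpha>_def)
    have "(sin (h x))\<^sup>2 - (cos (h x))\<^sup>2 \<le> 1"
      using sin_squared_eq[of "h x"] zero_le_power2[of "cos (h x)"] by linarith
    then have "(g x)\<^sup>2 * ((sin (h x))\<^sup>2 - (cos (h x))\<^sup>2) \<le> (g x)\<^sup>2 * 1"
      by (intro mult_left_mono) auto
    then have "\<alpha> * ((g x)\<^sup>2 * ((sin (h x))\<^sup>2 - (cos (h x))\<^sup>2)) \<le> \<alpha> * ((g x)\<^sup>2 * 1)"
      by (rule mult_left_mono) (use M in \<open>simp add: \<alpha>_def\<close>)
    also have "\<dots> \<le> 1/8 * ((g x)\<^sup>2 * 1)"
      using M by (intro mult_right_mono) (auto simp: \<alpha>_def field_simps)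
    finally have 3: "\<alpha> * ((g x)\<^sup>2 * ((sin (h x))\<^sup>2 - (cos (h x))\<^sup>2)) \<le> 1/8 * ((g x)\<^sup>2 * 1)" .
    have 4: "9/10 * (g x)\<^sup>2 \<le> damping x * (g x)\<^sup>2" using eb(2)[OF x(2)] M by (intro mult_right_mono) auto
    have 5: "\<alpha> * (M * ((g x)\<^sup>2 + (w x)\<^sup>2 / 4)) = (g x)\<^sup>2 / 4 + (w x)\<^sup>2 / 16"
      using M by (simp add: \<alpha>_def field_simps)
    have "1/8 * (w x)\<^sup>2 \<le> (\<alpha> * (M - 1/10)) * (w x)\<^sup>2"
      using M by (intro mult_right_mono) (auto simp: \<alpha>_def field_simps)
    then have 6: "\<alpha> * ((M - 1/10) * (w x)\<^sup>2) \<ge> (w x)\<^sup>2 / 8"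
      by (simp add: mult.assoc)
    have "L' x \<le> - damping x * (g x)\<^sup>2
        + \<alpha> * (damping x * (g x * w x)) - \<alpha> * (stiffness x * (w x)\<^sup>2)
        + \<alpha> * ((g x)\<^sup>2 * ((sin (h x))\<^sup>2 - (cos (h x))\<^sup>2))"
      using E_deriv_le[of x] unfolding L'_def by (simp add: algebra_simps power2_eq_square)
    also have "\<dots> \<le> - (1/2 * (g x)\<^sup>2) - 1/16 * (w x)\<^sup>2"
      using 1 2 3 4 5 6 zero_le_power2[of "g x"] by linarith
    finally have dis: "L' x \<le> - (1/2 * (g x)\<^sup>2) - 1/16 * (w x)\<^sup>2" .
    have m: "\<mu> \<le> 1" "0 < \<mu>"
    proof -
      have "1 * 1 \<le> M * M" using M by (intro mult_mono) auto
      then show "\<mu> \<le> 1" "0 < \<mu>" using S M by (auto simp: \<mu>_def power2_eq_square divide_le_eq)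
    qed
    have "(2 * S / (5 * M)) * (cos (h x))\<^sup>2 \<le> (w x)\<^sup>2"
      unfolding w_def power_mult_distrib using sin_gap[OF x] by (intro mult_right_mono) auto
    then have "\<mu> * (M / 2 * (cos (h x))\<^sup>2) \<le> 1/16 * (w x)\<^sup>2"
      using M by (simp add: \<mu>_def field_simps power2_eq_square)
    moreover have "\<mu> * (stiffness x / 2 * (cos (h x))\<^sup>2) \<le> \<mu> * (M / 2 * (cos (h x))\<^sup>2)"
      using m eb(5)[OF x(2)] by (intro mult_left_mono mult_right_mono) auto
    moreover have "\<mu> * (1/2 * (g x)\<^sup>2) \<le> 1/2 * (g x)\<^sup>2" using m by (simp add: mult_left_le_one_le)
    moreover have "\<mu> * energy x = \<mu> * (1/2 * (g x)\<^sup>2) + \<mu> * (stiffness x / 2 * (cos (h x))\<^sup>2)"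
      by (simp add: energy_def algebra_simps)
    ultimately show ?thesis using dis by linarith
  qed
  define \<nu> where "\<nu> = S / (40 * M\<^sup>2)"
  have decay: "L b * exp (\<nu> * b) \<le> L a * exp (\<nu> * a)"
  proof (rule DERIV_nonpos_imp_nonincreasing[OF ab])
    fix x assume x: "a \<le> x" "x \<le> b"
    have "((\<lambda>x. L x * exp (\<nu> * x)) has_real_derivative (L' x + \<nu> * L x) * exp (\<nu> * x)) (at x)"
      by (rule derivative_eq_intros refl Ld)+ (simp add: algebra_simps)
    moreover have "L' x + \<nu> * L x \<le> 0"
    proof -
      have "0 \<le> energy x" using comparable(3)[OF x(2)] by (smt (verit) sum_power2_ge_zero divide_nonneg_nonneg)
      have "\<nu> * L x \<le> \<nu> * (9/8 * energy x)"
        using comparable(2)[OF x(2)] S M by (intro mult_left_mono) (auto simp: \<nu>_def)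
      also have "\<dots> = (9/8 * \<nu>) * energy x" by simp
      also have "\<dots> \<le> \<mu> * energy x"
        using \<open>0 \<le> energy x\<close> S M by (intro mult_right_mono) (auto simp: \<nu>_def \<mu>_def field_simps)
      finally show ?thesis using L'_le[OF x] by simp
    qed
    ultimately show "\<exists>d. ((\<lambda>x. L x * exp (\<nu> * x)) has_real_derivative d) (at x) \<and> d \<le> 0"
      by (meson exp_ge_zero mult_nonpos_nonneg)
  qed
  have "L b = L b * exp (\<nu> * b) * exp (- \<nu> * b)" by (simp add: exp_minus)
  also have "\<dots> \<le> L a * exp (\<nu> * a) * exp (- \<nu> * b)" using decay by (intro mult_right_mono) auto
  also have "\<dots> = L a * exp (- \<nu> * (b - a))" by (simp add: algebra_simps flip: exp_add)
  also have "\<dots> \<le> (9/8 * (M / 2)) * exp (- \<nu> * (b - a))"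
    using comparable(2)[OF ab] Ea S by (intro mult_right_mono) auto
  finally have "L b \<le> (9/8 * (M / 2)) * exp (- \<nu> * (b - a))" .
  moreover have "(g b)\<^sup>2 + (cos (h b))\<^sup>2 \<le> 16/7 * L b"
    using comparable(1,3)[of b] by simp
  ultimately have "(g b)\<^sup>2 + (cos (h b))\<^sup>2 \<le> 16/7 * (9/8 * (M / 2) * exp (- \<nu> * (b - a)))" by linarith
  also have "\<dots> \<le> 3 * (M * exp (- \<nu> * (b - a)))" using M by simp
  finally show "(g b)\<^sup>2 + (cos (h b))\<^sup>2 \<le> 3 * M * exp (- ((sin \<theta>)\<^sup>2 / (40 * M\<^sup>2)) * (b - a))"
    by (simp add: \<nu>_def S_def)
qed


text \<open>
  The point \<open>(\<pi>/2, 0)\<close> of phase space is an equilibrium at all times, and the coefficients are bounded.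
\<close>
lemma equator_gronwall:
  assumes ab: "a \<le> b"
  shows "(g b)\<^sup>2 + (cos (h b))\<^sup>2
    \<le> ((g a)\<^sup>2 + (cos (h a))\<^sup>2) * exp ((3 * (M + N) + 1) * (b - a))"
proof -
  define K where "K = 3 * (M + N) + 1"
  define n where "n = (\<lambda>x. (g x)\<^sup>2 + (cos (h x))\<^sup>2)"
  define n' where "n' = (\<lambda>x. 2 * g x * (- damping x * g x + stiffness x * (sin (h x) * cos (h x)))
      - 2 * cos (h x) * sin (h x) * g x)"
  have nd: "(n has_real_derivative n' x) (at x)" for x
    unfolding n_def n'_def by (auto intro!: derivative_eq_intros g_deriv h_deriv)
  have n'_le: "n' x \<le> K * n x" for x
  proof -
    have l: "0 \<le> (M + N) * logistic x" "(M + N) * logistic x \<le> M + N"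
      "0 \<le> (M + N - 2) * logistic x" "(M + N - 2) * logistic x \<le> M + N - 2"
      using M N logistic_pos[of x] logistic_less_1[of x] by (auto simp: mult_le_cancel_left2)
    have d: "- damping x \<le> M + N" "\<bar>stiffness x - 1\<bar> \<le> M + N + 1"
      using l M N unfolding damping_def stiffness_def by linarith+
    have "\<bar>sin (h x)\<bar> * \<bar>cos (h x)\<bar> \<le> 1 * \<bar>cos (h x)\<bar>" by (intro mult_right_mono) auto
    then have "(sin (h x) * cos (h x))\<^sup>2 \<le> (cos (h x))\<^sup>2"
      by (simp add: abs_mult flip: abs_le_square_iff)
    moreover have "\<bar>2 * g x * (sin (h x) * cos (h x))\<bar> \<le> (g x)\<^sup>2 + (sin (h x) * cos (h x))\<^sup>2"
      using sum_squares_bound[of "\<bar>g x\<bar>" "\<bar>sin (h x) * cos (h x)\<bar>"] by (simp add: abs_mult mult.assoc power_mult_distrib)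
    ultimately have "\<bar>2 * g x * (sin (h x) * cos (h x))\<bar> \<le> n x" by (simp add: n_def)
    then have "\<bar>stiffness x - 1\<bar> * \<bar>2 * g x * (sin (h x) * cos (h x))\<bar> \<le> (M + N + 1) * n x"
      using d M N by (intro mult_mono) auto
    then have "(stiffness x - 1) * (2 * g x * (sin (h x) * cos (h x))) \<le> (M + N + 1) * n x"
      by (metis abs_le_D1 abs_mult)
    moreover have "- damping x * (2 * (g x)\<^sup>2) \<le> (M + N) * (2 * (g x)\<^sup>2)"
      using d by (intro mult_right_mono) auto
    moreover have "(M + N) * (2 * (g x)\<^sup>2) \<le> (M + N) * (2 * n x)"
      using M N by (intro mult_left_mono) (auto simp: n_def)
    ultimately show ?thesis by (simp add: n'_def K_def algebra_simps power2_eq_square)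
  qed
  have "n b * exp (- K * b) \<le> n a * exp (- K * a)"
  proof (rule DERIV_nonpos_imp_nonincreasing[OF ab])
    fix x
    have "((\<lambda>x. n x * exp (- K * x)) has_real_derivative (n' x - K * n x) * exp (- K * x)) (at x)"
      by (rule derivative_eq_intros refl nd)+ (simp add: algebra_simps)
    moreover have "(n' x - K * n x) * exp (- K * x) \<le> 0"
      using n'_le[of x] by (intro mult_nonpos_nonneg) auto
    ultimately show "\<exists>d. ((\<lambda>x. n x * exp (- K * x)) has_real_derivative d) (at x) \<and> d \<le> 0" by blast
  qed
  then have "n b * exp (- K * b) * exp (K * b) \<le> n a * exp (- K * a) * exp (K * b)"
    by (intro mult_right_mono) auto
  then have "n b \<le> n a * exp (K * (b - a))"
    by (simp add: mult.assoc algebra_simps flip: exp_add)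
  then show ?thesis by (simp add: n_def K_def)
qed

lemma equator_stays:
  assumes ab: "a \<le> b" and ha: "0 < h a" "h a < pi"
    and small: "((g a)\<^sup>2 + (cos (h a))\<^sup>2) * exp ((3 * (M + N) + 1) * (b - a)) < 1"
  shows "0 < h b \<and> h b < pi"
proof (rule no_multiple_of_pi_crossing[OF ab ha])
  fix x assume x: "a \<le> x" "x \<le> b"
  have "(cos (h x))\<^sup>2 \<le> (g x)\<^sup>2 + (cos (h x))\<^sup>2" by simp
  also have "\<dots> \<le> ((g a)\<^sup>2 + (cos (h a))\<^sup>2) * exp ((3 * (M + N) + 1) * (x - a))"
    by (rule equator_gronwall[OF x(1)])
  also have "\<dots> \<le> ((g a)\<^sup>2 + (cos (h a))\<^sup>2) * exp ((3 * (M + N) + 1) * (b - a))"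
    using x M N by (intro mult_left_mono) auto
  finally have "(cos (h x))\<^sup>2 < 1" using small by simp
  then show "sin (h x) \<noteq> 0" using sin_squared_eq[of "h x"] by auto
qed

section \<open>No escape from the equator at late times\<close>

text \<open>
  \<open>S\<close> compensates the energy for what the declining stiffness removes, which is at most 1/20 after \<open>X\<close>.
  Since friction is negative, \<open>S\<close> increases. While \<open>h\<close> crosses the bottom of the well, from
  \<open>3 \<pi> / 4\<close> to \<open>5 \<pi> / 4\<close>, the speed is at least 1/2, and \<open>S\<close> grows at least as fast as \<open>h / 4\<close>. The gain of
  \<open>\<pi> / 8 > 3/8\<close> lifts the energy above the unstable rest position for good. Then the speed never falls
  below 1/2 again, which contradicts convergence.
\<close>
lemma late_no_escape:
  assumes X: "(M + N) * (1 - logistic X) \<le> 1/10"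
    and small: "(g X)\<^sup>2 + (cos (h X))\<^sup>2 \<le> 1 / (10 * N)"
    and hX: "0 < h X" "h X < pi" and lim: "(h \<longlongrightarrow> l) at_top" and y: "X \<le> y"
  shows "h y < 5 * pi / 4"
proof (rule ccontr)
  assume "\<not> h y < 5 * pi / 4"
  then have hy: "5 * pi / 4 \<le> h y" by simp
  note lb = late_bounds[OF X]
  define S where "S = (\<lambda>x. energy x + (M + N) * logistic x / 2)"
  define S' where "S' = (\<lambda>x. - damping x * (g x)\<^sup>2
      + (M + N) * logistic x * (1 - logistic x) * (sin (h x))\<^sup>2)"
  have Sd: "(S has_real_derivative S' x) (at x)" for x
    unfolding S_def S'_def
    by (rule DERIV_cong[OF DERIV_add[OF energy_deriv
          DERIV_cdivide[OF DERIV_cmult[OF logistic_has_derivative]]]])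
      (simp add: sin_squared_eq field_simps)
  have S'_ge: "9/10 * (g x)\<^sup>2 \<le> S' x" if "X \<le> x" for x
  proof -
    have "9/10 * (g x)\<^sup>2 \<le> - damping x * (g x)\<^sup>2" using lb(1)[OF that] by (intro mult_right_mono) auto
    moreover have "0 \<le> (M + N) * logistic x * (1 - logistic x) * (sin (h x))\<^sup>2"
      using M N logistic_pos[of x] logistic_less_1[of x] by simp
    ultimately show ?thesis by (simp add: S'_def)
  qed
  have S_mono: "S u \<le> S w" if "X \<le> u" "u \<le> w" for u w
  proof (rule DERIV_nonneg_imp_nondecreasing[OF that(2)])
    fix x assume "u \<le> x" "x \<le> w"
    then have "0 \<le> S' x" using S'_ge[of x] that zero_le_power2[of "g x"] by linarith
    then show "\<exists>d. (S has_real_derivative d) (at x) \<and> d \<ge> 0" using Sd by blast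
  qed
  have EX: "- (1/20) \<le> energy X"
  proof -
    have "(cos (h X))\<^sup>2 \<le> 1 / (10 * N)" using small zero_le_power2[of "g X"] by linarith
    then have "N * (cos (h X))\<^sup>2 \<le> 1 / 10" using N by (simp add: field_simps)
    moreover have "- N * (cos (h X))\<^sup>2 \<le> stiffness X * (cos (h X))\<^sup>2"
      using lb(3)[of X] by (intro mult_right_mono) auto
    ultimately show ?thesis using zero_le_power2[of "g X"] unfolding energy_def mult_minus_left by argo
  qed
  have E_ge: "energy x \<ge> - (1/20) + (S u - S X) - 1/20" if "X \<le> u" "u \<le> x" for u x
  proof -
    have "(M + N) * (1 - logistic X) \<ge> (M + N) * (logistic x - logistic X)"
      using M N logistic_less_1[of x] by (intro mult_left_mono) auto
    then have "(M + N) * logistic x - (M + N) * logistic X \<le> 1/10" using X by (simp add: algebra_simps)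
    then show ?thesis using S_mono[OF that] EX by (simp add: S_def)
  qed
  have g_square: "(g x)\<^sup>2 \<ge> 2 * energy x + 19/10 * (cos (h x))\<^sup>2" if "X \<le> x" for x
    using mult_right_mono[OF lb(2)[OF that], OF zero_le_power2[of "cos (h x)"]] unfolding energy_def by argo
  have hcont: "continuous_on T h" for T
    by (intro continuous_at_imp_continuous_on ballI DERIV_isCont[OF h_deriv])
  have gcont: "continuous_on T g" for T
    by (intro continuous_at_imp_continuous_on ballI DERIV_isCont[OF g_deriv])
  have near: "1/2 \<le> (cos z)\<^sup>2" if "3 * pi / 4 \<le> z" "z \<le> 5 * pi / 4" for z
  proof -
    have "cos (2 * z) = cos (2 * z - 2 * pi)" by (simp add: cos_diff)
    also have "\<dots> \<ge> 0" using that by (intro cos_ge_zero) auto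
    finally show ?thesis by (simp add: cos_double_cos)
  qed
  have hX': "h X < 3 * pi / 4"
  proof (rule ccontr)
    assume "\<not> h X < 3 * pi / 4"
    then have "1/2 \<le> (cos (h X))\<^sup>2" using near[of "h X"] hX by simp
    moreover have "1 / (10 * N) \<le> 1/20" using N by (simp add: field_simps)
    ultimately show False using small zero_le_power2[of "g X"] by linarith
  qed
  obtain a where a: "X \<le> a" "a \<le> y" "h a \<le> 3 * pi / 4"
    and after: "\<And>x. a < x \<Longrightarrow> x \<le> y \<Longrightarrow> 3 * pi / 4 < h x"
  proof -
    define A where "A = {x \<in> {X..y}. h x \<le> 3 * pi / 4}"
    have "closed A" unfolding A_def
      by (intro continuous_on_closed_Collect_le hcont continuous_intros closed_atLeastAtMost)
    moreover have "bounded A"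
      by (rule bounded_subset[OF bounded_closed_interval[of X y]]) (auto simp: A_def)
    ultimately have "compact A" by (simp add: compact_eq_bounded_closed)
    moreover have "X \<in> A" using y hX' by (auto simp: A_def)
    ultimately obtain a where a: "a \<in> A" "\<And>z. z \<in> A \<Longrightarrow> z \<le> a"
      using compact_attains_sup[of A] by blast
    have "3 * pi / 4 < h x" if "a < x" "x \<le> y" for x
      using a(2)[of x] that a(1) unfolding A_def by force
    then show thesis using a(1) by (intro that[of a]) (simp_all add: A_def)
  qed
  obtain b where b: "a \<le> b" "b \<le> y" "5 * pi / 4 \<le> h b"
    and before: "\<And>x. a \<le> x \<Longrightarrow> x < b \<Longrightarrow> h x < 5 * pi / 4"
  proof -
    define B where "B = {x \<in> {a..y}. 5 * pi / 4 \<le> h x}"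
    have "closed B" unfolding B_def
      by (intro continuous_on_closed_Collect_le hcont continuous_intros closed_atLeastAtMost)
    moreover have "bounded B"
      by (rule bounded_subset[OF bounded_closed_interval[of a y]]) (auto simp: B_def)
    ultimately have "compact B" by (simp add: compact_eq_bounded_closed)
    moreover have "y \<in> B" using a hy by (auto simp: B_def)
    ultimately obtain b where b: "b \<in> B" "\<And>z. z \<in> B \<Longrightarrow> b \<le> z"
      using compact_attains_inf[of B] by blast
    have "h x < 5 * pi / 4" if "a \<le> x" "x < b" for x
      using b(2)[of x] that b(1) unfolding B_def by force
    then show thesis using b(1) by (intro that[of b]) (simp_all add: B_def)
  qed
  have "S a - h a / 4 \<le> S b - h b / 4"
  proof (rule DERIV_nonneg_imp_increasing_open[OF b(1)])
    fix x assume x: "a < x" "x < b"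
    have xX: "X \<le> x" using x a by simp
    have "1/2 \<le> (cos (h x))\<^sup>2" using near[of "h x"] after[of x] before[of x] x b by simp
    moreover have "- (1/10) \<le> energy x" using E_ge[OF order_refl xX] by simp
    ultimately have "(1/2)\<^sup>2 \<le> (g x)\<^sup>2" using g_square[OF xX] by (simp add: power2_eq_square)
    then have "1/2 \<le> \<bar>g x\<bar>" by (simp flip: abs_le_square_iff)
    then have "1/2 * \<bar>g x\<bar> \<le> \<bar>g x\<bar> * \<bar>g x\<bar>" by (intro mult_right_mono) auto
    then have "1/4 * g x \<le> S' x" using S'_ge[OF xX] by (simp add: power2_eq_square)
    moreover have "((\<lambda>x. S x - h x / 4) has_real_derivative S' x - g x / 4) (at x)"
      by (auto intro!: derivative_eq_intros Sd h_deriv)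
    ultimately show "\<exists>d. ((\<lambda>x. S x - h x / 4) has_real_derivative d) (at x) \<and> 0 \<le> d"
      by (intro exI[of _ "S' x - g x / 4"]) auto
  next
    show "continuous_on {a..b} (\<lambda>x. S x - h x / 4)"
      by (intro continuous_intros hcont continuous_at_imp_continuous_on ballI DERIV_isCont[OF Sd]) simp
  qed
  then have gain: "S b - S X \<ge> 3/8"
    using a b S_mono[OF order_refl a(1)] pi_gt3 by simp
  have fast: "1/2 \<le> \<bar>g x\<bar>" if "b \<le> x" for x
  proof -
    have "1/8 \<le> energy x" using E_ge[of b x] gain a b that by simp
    moreover have "0 \<le> (cos (h x))\<^sup>2" by simp
    ultimately have "1/4 \<le> (g x)\<^sup>2" using g_square[of x] a b that by linarith
    then have "(1/2)\<^sup>2 \<le> (g x)\<^sup>2" by (simp add: power_divide)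
    then show ?thesis by (simp flip: abs_le_square_iff)
  qed
  show False
  proof (cases "0 \<le> g b")
    case True
    have "1/2 \<le> g x" if "b \<le> x" for x
    proof (rule ccontr)
      assume "\<not> 1/2 \<le> g x"
      then have "g x \<le> 0" using fast[OF that] by simp
      then obtain z where "b \<le> z" "g z = 0"
        using IVT2'[of g x 0 b, OF _ True \<open>b \<le> x\<close> gcont] by blast
      then show False using fast[of z] by simp
    qed
    then show False using drift_not_convergent[OF h_deriv, of b "1/2"] lim by auto
  next
    case False
    have "1/2 \<le> - g x" if "b \<le> x" for x
    proof (rule ccontr)
      assume "\<not> 1/2 \<le> - g x"
      then have "0 \<le> g x" using fast[OF that] by simp
      then obtain z where "b \<le> z" "g z = 0"
        using IVT'[of g b 0 x, OF _ _ \<open>b \<le> x\<close> gcont] False by auto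
      then show False using fast[of z] by simp
    qed
    then show False
      using drift_not_convergent[OF DERIV_minus[OF h_deriv], of b "1/2"] tendsto_minus[OF lim] by auto
  qed
qed

text \<open>
  Reflection exchanges the two directions of escape from the equator.
\<close>
lemma pendulum_reflected: "pendulum M N (\<lambda>x. pi - h x) (\<lambda>x. - g x)"
proof
  show "((\<lambda>x. pi - h x) has_real_derivative - g x) (at x)" for x
    by (auto intro!: derivative_eq_intros h_deriv)
  show "((\<lambda>x. - g x) has_real_derivative
      - damping x * - g x + stiffness x * (sin (pi - h x) * cos (pi - h x))) (at x)" for x
    using DERIV_minus[OF g_deriv[of x]] by (simp add: algebra_simps)
qed

lemma limit_is_nearest_equator:
  fixes l :: int
  assumes X: "(M + N) * (1 - logistic X) \<le> 1/10"
    and small: "(g X)\<^sup>2 + (cos (h X))\<^sup>2 \<le> 1 / (10 * N)"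
    and hX: "0 < h X" "h X < pi" and lim: "(h \<longlongrightarrow> (2 * of_int l + 1) * (pi/2)) at_top"
  shows "l = 0"
proof -
  interpret refl: pendulum M N "\<lambda>x. pi - h x" "\<lambda>x. - g x" by (rule pendulum_reflected)
  have up: "h x < 5 * pi / 4" if "X \<le> x" for x
    by (rule late_no_escape[OF X small hX lim that])
  have "pi - h x < 5 * pi / 4" if "X \<le> x" for x
    by (rule refl.late_no_escape[OF X _ _ _ tendsto_diff[OF tendsto_const lim] that]) (use small hX in auto)
  then have down: "- pi / 4 \<le> h x" if "X \<le> x" for x using that by force
  have "(2 * of_int l + 1) * (pi/2) \<le> 5 * pi / 4"
    by (rule tendsto_upperbound[OF lim])
      (use up in \<open>auto simp: eventually_at_top_linorder intro!: exI[of _ X] less_imp_le\<close>)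
  then have "2 * real_of_int l + 1 \<le> 5/2" by (simp add: field_simps)
  moreover have "- pi / 4 \<le> (2 * of_int l + 1) * (pi/2)"
    by (rule tendsto_lowerbound[OF lim])
      (use down in \<open>auto simp: eventually_at_top_linorder intro!: exI[of _ X]\<close>)
  then have "- (1/2) * pi \<le> (2 * real_of_int l + 1) * pi" by simp
  then have "- (1/2) \<le> 2 * real_of_int l + 1" using pi_gt_zero by (simp only: mult_le_cancel_right_pos)
  ultimately show ?thesis by linarith
qed

end

context pendulum_parameters begin

text \<open>
  The times \<open>b\<close> and \<open>X\<close> depend on \<open>M\<close> and \<open>N\<close> only. The decay until \<open>b\<close> has to beat the factor \<open>G\<close>
  which the Gronwall estimate loses from \<open>b\<close> to \<open>X\<close>; this determines \<open>v0\<close>.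
\<close>
lemma fast_departure_limit:
  "\<exists>v0>0. \<forall>h g v (l::int). pendulum M N h g \<longrightarrow> (h \<longlongrightarrow> 0) at_bot \<longrightarrow>
     ((\<lambda>x. h x * exp (- x)) \<longlongrightarrow> v) at_bot \<longrightarrow>
     (h \<longlongrightarrow> (2 * of_int l + 1) * (pi/2)) at_top \<longrightarrow> v0 \<le> v \<longrightarrow> l = 0"
proof -
  define S where "S = (sin takeoff)\<^sup>2"
  have S: "0 < S" "S \<le> 1"
    using takeoff_bounds pi_gt3 sin_gt_zero[of takeoff] by (auto simp: S_def abs_square_le_1)
  define \<nu> where "\<nu> = S / (40 * M\<^sup>2)"
  have \<nu>: "0 < \<nu>" using S M by (simp add: \<nu>_def)
  define b where "b = ln (S / (20 * (M + N))) / 2"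
  have "exp (2 * b) = S / (20 * (M + N))" using S M N by (simp add: b_def)
  then have b: "(M + N) * exp (2 * b) = S / 20" using M N by (simp add: divide_simps) (simp add: algebra_simps)
  define X where "X = max b (ln (10 * (M + N)) / 2)"
  have bX: "b \<le> X" by (simp add: X_def)
  have X: "(M + N) * (1 - logistic X) \<le> 1/10"
  proof -
    have "1 - logistic X \<le> exp (- (2 * X))" using logistic_le_exp[of "-X"] by (simp add: one_minus_logistic)
    also have "\<dots> \<le> exp (- ln (10 * (M + N)))" by (simp add: X_def)
    also have "\<dots> = 1 / (10 * (M + N))" using M N by (simp add: exp_minus inverse_eq_divide)
    finally have "(M + N) * (1 - logistic X) \<le> (M + N) * (1 / (10 * (M + N)))"
      using M N by (intro mult_left_mono) auto
    also have "\<dots> = 1/10" using M N by (simp add: divide_simps)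
    finally show ?thesis .
  qed
  define G where "G = exp ((3 * (M + N) + 1) * (X - b))"
  have G: "0 < G" by (simp add: G_def)
  define y0 where "y0 = ln (30 * M * N * G)"
  define v0 where "v0 = exp (max (- b) (y0 / \<nu> - b))"
  have "l = 0" if "pendulum M N h g" and lim0: "(h \<longlongrightarrow> 0) at_bot"
      and vel: "((\<lambda>x. h x * exp (- x)) \<longlongrightarrow> v) at_bot"
      and lim: "(h \<longlongrightarrow> (2 * of_int l + 1) * (pi/2)) at_top" and v: "v0 \<le> v"
    for h g v and l :: int
  proof -
    interpret pendulum M N h g by fact
    have vpos: "0 < v" using v by (smt (verit) v0_def exp_gt_zero)
    have lnv: "max (- b) (y0 / \<nu> - b) \<le> ln v"
      using v vpos unfolding v0_def by (simp only: ln_ge_iff)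
    have "(M + N) * exp (2 * (- ln v)) \<le> (M + N) * exp (2 * b)"
      using lnv M N by (intro mult_left_mono) auto
    then have "(M + N) * exp (2 * (- ln v)) \<le> 1/10" using b S by simp
    from reaches_takeoff[OF lim0 vel vpos this]
    obtain a where a: "a \<le> - ln v" "h a = takeoff" "0 \<le> g a" "g a \<le> 6/5 * sin takeoff"
      by blast
    have ab: "a \<le> b" using a lnv by simp
    have at_b: "(g b)\<^sup>2 + (cos (h b))\<^sup>2 \<le> 3 * M * exp (- \<nu> * (b - a))" "0 < h b \<and> h b < pi"
      using decay_to_equator[OF a(2-4) takeoff_bounds ab] b by (simp_all add: \<nu>_def S_def)
    have "y0 \<le> \<nu> * (b + ln v)" using lnv \<nu> by (simp add: field_simps)
    also have "\<dots> \<le> \<nu> * (b - a)" using a \<nu> by (intro mult_left_mono) auto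
    finally have "exp (- \<nu> * (b - a)) \<le> exp (- y0)" by simp
    also have "\<dots> = 1 / (30 * M * N * G)" using M N G by (simp add: y0_def exp_minus inverse_eq_divide)
    finally have "3 * M * exp (- \<nu> * (b - a)) \<le> 3 * M * (1 / (30 * M * N * G))"
      using M by (intro mult_left_mono) auto
    also have "\<dots> = 1 / (10 * N * G)" using M N G by (simp add: field_simps)
    finally have "(g b)\<^sup>2 + (cos (h b))\<^sup>2 \<le> 1 / (10 * N * G)" using at_b by simp
    then have "((g b)\<^sup>2 + (cos (h b))\<^sup>2) * G \<le> 1 / (10 * N * G) * G"
      using G by (intro mult_right_mono) auto
    then have small: "((g b)\<^sup>2 + (cos (h b))\<^sup>2) * G \<le> 1 / (10 * N)" using G by simp
    also have "1 / (10 * N) < 1" using N by simp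
    finally have "0 < h X \<and> h X < pi"
      using equator_stays[OF bX] at_b by (simp add: G_def)
    moreover have "(g X)\<^sup>2 + (cos (h X))\<^sup>2 \<le> 1 / (10 * N)"
      using equator_gronwall[OF bX] small by (simp add: G_def)
    ultimately show "l = 0"
      using limit_is_nearest_equator[OF X _ _ _ lim] by blast
  qed
  then show ?thesis by (intro exI[of _ v0]) (auto simp: v0_def)
qed

end

section \<open>From the boundary value problem to the pendulum\<close>

lemma arctan_exp_bounds: "0 < arctan (exp x)" "arctan (exp x) < pi/2"
  using arctan_ubound by auto

lemma sin_arctan_exp: "(sin (arctan (exp x)))\<^sup>2 = logistic x"
  and cos_arctan_exp: "(cos (arctan (exp x)))\<^sup>2 = 1 - logistic x"
proof -
  have "0 < 1 + (exp x)\<^sup>2" by (simp add: add_pos_nonneg)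
  then show "(sin (arctan (exp x)))\<^sup>2 = logistic x" "(cos (arctan (exp x)))\<^sup>2 = 1 - logistic x"
    unfolding logistic_def exp_double by (simp_all add: sin_arctan cos_arctan power_divide field_simps)
qed

lemma arctan_exp_deriv:
  "((\<lambda>x. arctan (exp x)) has_real_derivative sin (arctan (exp x)) * cos (arctan (exp x))) (at x)"
proof -
  have "sin (arctan (exp x)) * cos (arctan (exp x)) = inverse (1 + (exp x)\<^sup>2) * exp x"
    by (simp add: sin_arctan cos_arctan field_simps add_nonneg_nonneg)
  then show ?thesis by (auto intro!: derivative_eq_intros)
qed

lemma filterlim_arctan_exp_at_bot: "filterlim (\<lambda>x. arctan (exp x)) (at_right 0) at_bot"
proof (rule filterlim_at_withinI)
  have "((\<lambda>x. arctan (exp x)) \<longlongrightarrow> arctan 0) at_bot" by (intro tendsto_intros exp_at_bot)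
  then show "((\<lambda>x. arctan (exp x)) \<longlongrightarrow> 0) at_bot" by simp
qed (simp add: arctan_exp_bounds)

lemma filterlim_arctan_exp_at_top: "filterlim (\<lambda>x. arctan (exp x)) (at_left (pi/2)) at_top"
proof (rule filterlim_at_withinI)
  show "((\<lambda>x. arctan (exp x)) \<longlongrightarrow> pi/2) at_top"
    by (rule filterlim_compose[OF tendsto_arctan_at_top exp_at_top])
qed (use arctan_exp_bounds in \<open>auto simp: less_imp_neq\<close>)

text \<open>
  The chain rule for \<open>t = arctan (exp x)\<close>, for which \<open>dt/dx = sin t cos t\<close>: the left-hand side is the second
  derivative of \<open>r(t)\<close> with respect to \<open>x\<close>.
\<close>
lemma ode_rhs_in_log_time:
  assumes "0 < s" "0 < c" and s2: "(sin t)\<^sup>2 = l" and c2: "(cos t)\<^sup>2 = 1 - l"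
    and s: "s = sin t" and c: "c = cos t"
  shows "ode_rhs m0 m1 t x v * (s * c)\<^sup>2 + v * (s * c) * (c\<^sup>2 - s\<^sup>2)
     = - ((real m0 - 1) - (real m0 + real m1 - 2) * l) * (v * (s * c))
       + (real m0 - (real m0 + real m1) * l) * (sin x * cos x)"
proof -
  have sc: "s\<^sup>2 = l" "c\<^sup>2 = 1 - l" using s2 c2 s c by auto
  have ne: "s \<noteq> 0" "c \<noteq> 0" using assms by auto
  have 1: "((real m1 - real m0) * inverse (sin (2 * t)) - (real m0 + real m1) * cot (2 * t)) * (s * c)
      = - real m0 + (real m0 + real m1) * l"
  proof -
    have "inverse (sin (2 * t)) = 1 / (2 * (s * c))" "cot (2 * t) = (1 - 2 * l) / (2 * (s * c))"
      using sc s c by (simp_all add: cot_def sin_double cos_double inverse_eq_divide mult.assoc)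
    then have "((real m1 - real m0) * inverse (sin (2 * t)) - (real m0 + real m1) * cot (2 * t)) * (s * c)
        = ((real m1 - real m0) * (1 / (2 * (s * c))) - (real m0 + real m1) * ((1 - 2 * l) / (2 * (s * c)))) * (s * c)"
      by (simp only:)
    also have "\<dots> = - real m0 + (real m0 + real m1) * l" using ne by (simp add: field_simps)
    finally show ?thesis .
  qed
  have 2: "- real m1 * (sin (2 * x) / (2 * (cos t)\<^sup>2)) * (s * c)\<^sup>2 = - real m1 * (sin x * cos x) * s\<^sup>2"
    using ne unfolding c[symmetric] by (simp add: sin_double power_mult_distrib)
  have 3: "real m0 * (sin (2 * x) / (2 * (sin t)\<^sup>2)) * (s * c)\<^sup>2 = real m0 * (sin x * cos x) * c\<^sup>2"
    using ne unfolding s[symmetric] by (simp add: sin_double power_mult_distrib)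
  have "ode_rhs m0 m1 t x v * (s * c)\<^sup>2
      = ((real m1 - real m0) * inverse (sin (2 * t)) - (real m0 + real m1) * cot (2 * t)) * (s * c) * (v * (s * c))
        + (- real m1 * (sin (2 * x) / (2 * (cos t)\<^sup>2)) * (s * c)\<^sup>2)
        + real m0 * (sin (2 * x) / (2 * (sin t)\<^sup>2)) * (s * c)\<^sup>2"
    unfolding ode_rhs_def by (simp add: power2_eq_square algebra_simps)
  also have "\<dots> = (- real m0 + (real m0 + real m1) * l) * (v * (s * c))
      + (- real m1 * (sin x * cos x) * s\<^sup>2) + real m0 * (sin x * cos x) * c\<^sup>2"
    unfolding 1 2 3 ..
  finally show ?thesis unfolding sc by (simp add: algebra_simps)
qed

lemma ode_solution_pendulum:
  assumes ode: "ode_solution m0 m1 r" and m: "2 \<le> m0" "2 \<le> m1"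
  shows "pendulum (real m0) (real m1) (\<lambda>x. r (arctan (exp x)))
    (\<lambda>x. deriv r (arctan (exp x)) * (sin (arctan (exp x)) * cos (arctan (exp x))))"
proof -
  interpret pendulum_parameters "real m0" "real m1" using m by unfold_locales auto
  show ?thesis
  proof
    fix x
    let ?t = "arctan (exp x)"
    have t: "?t \<in> {0<..<pi/2}" using arctan_exp_bounds by auto
    have r1: "(r has_real_derivative deriv r ?t) (at ?t)"
      and r2: "(deriv r has_real_derivative ode_rhs m0 m1 ?t (r ?t) (deriv r ?t)) (at ?t)"
      using ode t by (auto simp: ode_solution_def)
    show "((\<lambda>x. r (arctan (exp x))) has_real_derivative deriv r ?t * (sin ?t * cos ?t)) (at x)"
      by (rule DERIV_chain2[OF r1 arctan_exp_deriv])
    have d: "((\<lambda>x. deriv r (arctan (exp x))) has_real_derivative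
        ode_rhs m0 m1 ?t (r ?t) (deriv r ?t) * (sin ?t * cos ?t)) (at x)"
      by (rule DERIV_chain2[OF r2 arctan_exp_deriv])
    have pos: "0 < sin ?t" "0 < cos ?t" using arctan_exp_bounds[of x] by (intro sin_gt_zero cos_gt_zero; linarith)+
    show "((\<lambda>x. deriv r (arctan (exp x)) * (sin (arctan (exp x)) * cos (arctan (exp x)))) has_real_derivative
        - damping x * (deriv r ?t * (sin ?t * cos ?t)) + stiffness x * (sin (r ?t) * cos (r ?t))) (at x)"
      unfolding damping_def stiffness_def
        ode_rhs_in_log_time[OF pos sin_arctan_exp cos_arctan_exp refl refl, symmetric]
      by (rule derivative_eq_intros refl d DERIV_chain2[OF DERIV_sin arctan_exp_deriv]
          DERIV_chain2[OF DERIV_cos arctan_exp_deriv])+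
        (simp add: power2_eq_square algebra_simps)
  qed
qed

lemma initial_velocity_in_log_time:
  assumes bvp: "bvp_solution m0 m1 r" and vel: "has_initial_velocity r v"
  shows "((\<lambda>x. r (arctan (exp x)) * exp (- x)) \<longlongrightarrow> v) at_bot"
proof -
  have "((\<lambda>t. endpoint_ext r t / t) \<longlongrightarrow> v) (at 0 within {0..pi/2})"
    using vel endpoint_ext_bvp(1)[OF bvp]
    by (simp add: has_initial_velocity_def has_field_derivative_iff)
  then have "((\<lambda>t. endpoint_ext r t / t) \<longlongrightarrow> v) (at_right 0)"
    by (simp add: at_within_Icc_at_right)
  moreover have "eventually (\<lambda>t. endpoint_ext r t / t = r t / t) (at_right 0)"
    using eventually_at_right_less eventually_at_right_real[of 0 "pi/2"]
    by (auto elim!: eventually_mono simp: endpoint_ext_def)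
  ultimately have "((\<lambda>t. r t / t) \<longlongrightarrow> v) (at_right 0)"
    by (rule Lim_transform_eventually)
  then have "((\<lambda>x. r (arctan (exp x)) / arctan (exp x)) \<longlongrightarrow> v) at_bot"
    by (rule filterlim_compose[OF _ filterlim_arctan_exp_at_bot])
  moreover have "((\<lambda>x. arctan (exp x) / exp x) \<longlongrightarrow> (1::real)) at_bot"
  proof -
    have "(arctan has_real_derivative inverse (1 + 0\<^sup>2)) (at 0)" by (rule DERIV_arctan)
    then have "((\<lambda>y. arctan y / y) \<longlongrightarrow> (1::real)) (at 0)"
      by (simp add: has_field_derivative_iff)
    then show ?thesis
      by (rule filterlim_compose) (auto simp: filterlim_at exp_at_bot)
  qed
  ultimately have "((\<lambda>x. r (arctan (exp x)) / arctan (exp x) * (arctan (exp x) / exp x)) \<longlongrightarrow> v * 1) at_bot"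
    by (rule tendsto_mult)
  moreover have "r (arctan (exp x)) / arctan (exp x) * (arctan (exp x) / exp x)
      = r (arctan (exp x)) * exp (- x)" for x
    using arctan_exp_bounds(1)[of x] by (simp add: exp_minus divide_inverse)
  ultimately show ?thesis by simp
qed

lemma fast_solution_ends_at_half_pi:
  assumes m: "2 \<le> m0" "2 \<le> m1"
  shows "\<exists>v0>0. \<forall>r v (l::int). bvp_solution m0 m1 r \<longrightarrow> has_initial_velocity r v \<longrightarrow> v0 \<le> v \<longrightarrow>
     (r \<longlongrightarrow> (2 * of_int l + 1) * (pi/2)) (at_left (pi/2)) \<longrightarrow> l = 0"
proof -
  interpret pendulum_parameters "real m0" "real m1" using m by unfold_locales auto
  obtain v0 where v0: "v0 > 0" and *: "\<And>h g v (l::int). pendulum m0 m1 h g \<Longrightarrow> (h \<longlongrightarrow> 0) at_bot \<Longrightarrow>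
     ((\<lambda>x. h x * exp (- x)) \<longlongrightarrow> v) at_bot \<Longrightarrow>
     (h \<longlongrightarrow> (2 * of_int l + 1) * (pi/2)) at_top \<Longrightarrow> v0 \<le> v \<Longrightarrow> l = 0"
    using fast_departure_limit by blast
  have "l = 0" if bvp: "bvp_solution m0 m1 r" and vel: "has_initial_velocity r v" and v: "v0 \<le> v"
    and lim: "(r \<longlongrightarrow> (2 * of_int l + 1) * (pi/2)) (at_left (pi/2))" for r v and l :: int
  proof (rule *[OF ode_solution_pendulum[OF _ m] _ initial_velocity_in_log_time[OF bvp vel] _ v])
    show "ode_solution m0 m1 r" using bvp by (simp add: bvp_solution_def)
    show "((\<lambda>x. r (arctan (exp x))) \<longlongrightarrow> 0) at_bot"
      by (rule filterlim_compose[OF _ filterlim_arctan_exp_at_bot])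
        (use bvp in \<open>simp add: bvp_solution_def\<close>)
    show "((\<lambda>x. r (arctan (exp x))) \<longlongrightarrow> (2 * of_int l + 1) * (pi/2)) at_top"
      by (rule filterlim_compose[OF lim filterlim_arctan_exp_at_top])
  qed
  then show ?thesis using v0 by blast
qed

section \<open>Maps of a sphere that respect its join structure\<close>

lemma compact_space_nsphere: "compact_space (nsphere n)"
  unfolding nsphere
proof (rule compact_space_subtopology, rule closed_compactin)
  show "compactin (powertop_real UNIV) (PiE UNIV (\<lambda>i. {-1..1}))"
    by (simp add: compactin_PiE)
  have "\<bar>x i\<bar> \<le> 1" if "(\<Sum>i\<le>n. (x i)\<^sup>2) = 1" "\<forall>i>n. x i = 0" for x :: "nat \<Rightarrow> real" and i
  proof (cases "i \<le> n")
    case True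
    then have "(x i)\<^sup>2 \<le> (\<Sum>i\<le>n. (x i)\<^sup>2)" by (intro member_le_sum) auto
    then show ?thesis using that by (simp add: abs_square_le_1)
  qed (use that in simp)
  then show "{x. (\<Sum>i\<le>n. (x i)\<^sup>2) = 1 \<and> (\<forall>i>n. x i = 0)} \<subseteq> PiE UNIV (\<lambda>i. {-1..1::real})"
    by (fastforce simp: abs_le_iff)
  have "closedin (powertop_real UNIV)
      ({x \<in> topspace (powertop_real UNIV). (\<Sum>i\<le>n. (x i)\<^sup>2) = 1}
        \<inter> (\<Inter>i\<in>{n<..}. {x \<in> topspace (powertop_real UNIV). x i = 0}))"
    by (intro closedin_Int closedin_INT closedin_continuous_maps_eq[where Y = euclideanreal]
        continuous_intros continuous_map_product_projection) auto
  also have "({x \<in> topspace (powertop_real UNIV). (\<Sum>i\<le>n. (x i)\<^sup>2) = 1}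
        \<inter> (\<Inter>i\<in>{n<..}. {x \<in> topspace (powertop_real UNIV). x i = 0}))
      = {x. (\<Sum>i\<le>n. (x i)\<^sup>2) = 1 \<and> (\<forall>i>n. x i = 0)}"
    by auto
  finally show "closedin (powertop_real UNIV) {x. (\<Sum>i\<le>n. (x i)\<^sup>2) = 1 \<and> (\<forall>i>n. x i = 0)}" .
qed

lemma Hausdorff_space_nsphere: "Hausdorff_space (nsphere n)"
  unfolding nsphere by (intro Hausdorff_space_subtopology) (simp add: Hausdorff_space_product_topology)

text \<open>
  Multiplication by the imaginary unit when the coordinates \<open>0, 1\<close>, then \<open>2, 3\<close>, and so on, are paired
  to complex numbers. For odd \<open>m\<close> it is a continuous field of unit tangent vectors on \<open>nsphere m\<close>.
\<close>
definition quarter_turn :: "(nat \<Rightarrow> real) \<Rightarrow> nat \<Rightarrow> real" where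
  "quarter_turn x i = (if even i then - x (Suc i) else x (i - 1))"

text \<open>
  Multiplication by the complex number \<open>a + i b\<close>.
\<close>
definition twist :: "real \<Rightarrow> real \<Rightarrow> (nat \<Rightarrow> real) \<Rightarrow> nat \<Rightarrow> real" where
  "twist a b x = (\<lambda>i. a * x i + b * quarter_turn x i)"

lemma sum_twist:
  assumes "odd m"
  shows "(\<Sum>i\<le>m. (twist a b x i)\<^sup>2) = (a\<^sup>2 + b\<^sup>2) * (\<Sum>i\<le>m. (x i)\<^sup>2)"
proof -
  have "(\<Sum>i\<le>Suc (2 * k). (twist a b x i)\<^sup>2) = (a\<^sup>2 + b\<^sup>2) * (\<Sum>i\<le>Suc (2 * k). (x i)\<^sup>2)" for k
  proof (induction k)
    case 0
    show ?case by (simp add: twist_def quarter_turn_def power2_eq_square algebra_simps)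
  next
    case (Suc k)
    have step: "(\<Sum>i\<le>Suc (2 * Suc k). f i) = (\<Sum>i\<le>Suc (2 * k). f i) + f (2 * k + 2) + f (2 * k + 3)"
      for f :: "nat \<Rightarrow> real" by (simp add: numeral_3_eq_3)
    have pair: "(twist a b x (2 * k + 2))\<^sup>2 + (twist a b x (2 * k + 3))\<^sup>2
        = (a\<^sup>2 + b\<^sup>2) * ((x (2 * k + 2))\<^sup>2 + (x (2 * k + 3))\<^sup>2)"
      by (simp add: twist_def quarter_turn_def numeral_3_eq_3 power2_eq_square algebra_simps)
    show ?case
      unfolding step Suc.IH using pair by (simp add: distrib_left)
  qed
  then show ?thesis using assms by (auto elim: oddE)
qed

lemma twist_nsphere:
  assumes x: "x \<in> topspace (nsphere m)" and b: "b = 0 \<or> odd m"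
  shows "(\<Sum>i\<le>m. (twist a b x i)\<^sup>2) = a\<^sup>2 + b\<^sup>2" and "\<forall>i>m. twist a b x i = 0"
proof -
  have x': "(\<Sum>i\<le>m. (x i)\<^sup>2) = 1" "\<And>i. i > m \<Longrightarrow> x i = 0" using x by (auto simp: topspace_nsphere_iff)
  show "(\<Sum>i\<le>m. (twist a b x i)\<^sup>2) = a\<^sup>2 + b\<^sup>2"
  proof (cases "odd m")
    case True
    then show ?thesis using sum_twist x' by simp
  next
    case False
    then show ?thesis using b x'
      by (simp add: twist_def power_mult_distrib flip: sum_distrib_left)
  qed
  show "\<forall>i>m. twist a b x i = 0"
  proof (intro allI impI)
    fix i assume i: "m < i"
    have "b * quarter_turn x i = 0"
    proof (cases "b = 0")
      case False
      then have "odd m" using b by simp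
      then have "odd i \<Longrightarrow> m < i - 1" using i by (auto elim!: oddE) 
      then show ?thesis using i by (auto simp: quarter_turn_def x')
    qed simp
    then show "twist a b x i = 0" using i by (simp add: twist_def x')
  qed
qed

lemma join_pt_nsphere:
  assumes "\<forall>i>m1. x2 i = 0"
    and "(\<Sum>i\<le>m0. (x1 i)\<^sup>2) + (\<Sum>i\<le>m1. (x2 i)\<^sup>2) = 1"
  shows "join_pt m0 1 x1 1 x2 \<in> topspace (nsphere (m0 + m1 + 1))"
proof -
  have "(\<Sum>i\<le>m0 + m1 + 1. (join_pt m0 1 x1 1 x2 i)\<^sup>2)
      = (\<Sum>i\<le>m0. (x1 i)\<^sup>2) + (\<Sum>i=Suc m0..m0 + m1 + 1. (x2 (i - Suc m0))\<^sup>2)"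
  proof -
    have "{..m0 + m1 + 1} = {..m0} \<union> {Suc m0..m0 + m1 + 1}" by auto
    then show ?thesis by (subst sum.union_disjoint[symmetric] | simp add: join_pt_def sum.union_disjoint)+
  qed
  also have "(\<Sum>i=Suc m0..m0 + m1 + 1. (x2 (i - Suc m0))\<^sup>2) = (\<Sum>i\<le>m1. (x2 i)\<^sup>2)"
    by (rule sum.reindex_bij_witness[of _ "\<lambda>i. i + Suc m0" "\<lambda>i. i - Suc m0"]) auto
  finally show ?thesis using assms by (auto simp: topspace_nsphere_iff join_pt_def)
qed

definition twisted_join ::
  "nat \<Rightarrow> real \<Rightarrow> real \<Rightarrow> (nat \<Rightarrow> real) \<Rightarrow> real \<Rightarrow> real \<Rightarrow> (nat \<Rightarrow> real) \<Rightarrow> nat \<Rightarrow> real" where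
  "twisted_join m0 a b x1 c d x2 = join_pt m0 1 (twist a b x1) 1 (twist c d x2)"

lemma twisted_join_untwisted: "twisted_join m0 a 0 x1 c 0 x2 = join_pt m0 a x1 c x2"
  by (auto simp: twisted_join_def twist_def join_pt_def)

lemma twist_0 [simp]: "twist 0 0 x = (\<lambda>i. 0)"
  by (simp add: twist_def)

lemma twisted_join_nsphere:
  assumes "x1 \<in> topspace (nsphere m0)" "x2 \<in> topspace (nsphere m1)"
    and "b = 0 \<or> odd m0" "d = 0 \<or> odd m1" and "a\<^sup>2 + b\<^sup>2 + c\<^sup>2 + d\<^sup>2 = 1"
  shows "twisted_join m0 a b x1 c d x2 \<in> topspace (nsphere (m0 + m1 + 1))"
  unfolding twisted_join_def
  by (rule join_pt_nsphere) (use assms twist_nsphere in auto)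

lemma join_pt_eqD:
  assumes x: "x1 \<in> topspace (nsphere m0)" "x2 \<in> topspace (nsphere m1)"
    and y: "y1 \<in> topspace (nsphere m0)" "y2 \<in> topspace (nsphere m1)"
    and ts: "t \<in> {0..pi/2}" "s \<in> {0..pi/2}"
    and p: "join_pt m0 (sin t) x1 (cos t) x2 = join_pt m0 (sin s) y1 (cos s) y2"
  shows "t = s" "t = 0 \<or> x1 = y1" "t = pi/2 \<or> x2 = y2"
proof -
  have eq1: "sin t * x1 i = sin s * y1 i" for i
  proof (cases "i \<le> m0")
    case True
    then show ?thesis using fun_cong[OF p, of i] by (simp add: join_pt_def)
  qed (use x y in \<open>simp add: topspace_nsphere_iff\<close>)
  have eq2: "cos t * x2 i = cos s * y2 i" for i
    using fun_cong[OF p, of "i + Suc m0"] by (simp add: join_pt_def)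
  have "(sin t)\<^sup>2 * (\<Sum>i\<le>m0. (x1 i)\<^sup>2) = (sin s)\<^sup>2 * (\<Sum>i\<le>m0. (y1 i)\<^sup>2)"
    unfolding sum_distrib_left power_mult_distrib[symmetric] by (simp add: eq1)
  then have "(sin t)\<^sup>2 = (sin s)\<^sup>2"
    using x y by (simp add: topspace_nsphere_iff)
  moreover have "sin t \<ge> 0" "sin s \<ge> 0"
    using ts pi_gt_zero by (auto intro!: sin_ge_zero)
  ultimately have "sin t = sin s"
    by (metis power2_eq_imp_eq)
  then show st: "t = s"
    using ts sin_inj_pi[of t s] by auto
  show "t = 0 \<or> x1 = y1"
  proof (cases "t = 0")
    case False
    then have "sin t > 0" using ts by (intro sin_gt_zero) auto
    then show ?thesis using eq1 st by (simp add: fun_eq_iff)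
  qed simp
  show "t = pi/2 \<or> x2 = y2"
  proof (cases "t = pi/2")
    case False
    then have "cos t > 0" using ts by (intro cos_gt_zero_pi) auto
    then show ?thesis using eq2 st by (simp add: fun_eq_iff)
  qed simp
qed

text \<open>
  Polar coordinates; where \<open>y = 0\<close> the direction \<open>x\<close> is an arbitrary point of the sphere.
\<close>
lemma normalized_block:
  fixes y :: "nat \<Rightarrow> real"
  assumes "\<forall>i>m. y i = 0"
  obtains x where "x \<in> topspace (nsphere m)" "\<And>i. y i = sqrt (\<Sum>i\<le>m. (y i)\<^sup>2) * x i"
proof (cases "(\<Sum>i\<le>m. (y i)\<^sup>2) = 0")
  case True
  then have "y i = 0" for i
  proof (cases "i \<le> m")
    case i: True
    have "(y i)\<^sup>2 \<le> (\<Sum>i\<le>m. (y i)\<^sup>2)" using i by (intro member_le_sum) auto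
    with True show ?thesis by simp
  qed (use assms in simp)
  moreover have "(\<lambda>n. if n = 0 then 1 else 0) \<in> topspace (nsphere m)" by (rule in_topspace_nsphere)
  ultimately show thesis using that True by simp
next
  case False
  define R where "R = sqrt (\<Sum>i\<le>m. (y i)\<^sup>2)"
  have R: "R\<^sup>2 = (\<Sum>i\<le>m. (y i)\<^sup>2)" "R \<noteq> 0"
    using False by (simp_all add: R_def sum_nonneg)
  show thesis
  proof (rule that[of "\<lambda>i. y i / R"])
    have "(\<Sum>i\<le>m. (y i / R)\<^sup>2) = (\<Sum>i\<le>m. (y i)\<^sup>2) / R\<^sup>2"
      by (simp add: power_divide sum_divide_distrib)
    then show "(\<lambda>i. y i / R) \<in> topspace (nsphere m)"
      using R False assms by (simp add: topspace_nsphere_iff)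
    show "y i = sqrt (\<Sum>i\<le>m. (y i)\<^sup>2) * (y i / R)" for i
      using R by (simp add: R_def[symmetric])
  qed
qed

lemma join_pt_surj:
  assumes p: "p \<in> topspace (nsphere (m0 + m1 + 1))"
  obtains t x1 x2 where "t \<in> {0..pi/2}" "x1 \<in> topspace (nsphere m0)" "x2 \<in> topspace (nsphere m1)"
    "p = join_pt m0 (sin t) x1 (cos t) x2"
proof -
  define y1 where "y1 = (\<lambda>i. if i \<le> m0 then p i else 0)"
  define y2 where "y2 = (\<lambda>i. p (i + Suc m0))"
  have p': "(\<Sum>i\<le>m0 + m1 + 1. (p i)\<^sup>2) = 1" "\<forall>i>m0 + m1 + 1. p i = 0"
    using p by (auto simp: topspace_nsphere_iff)
  define R1 where "R1 = sqrt (\<Sum>i\<le>m0. (y1 i)\<^sup>2)"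
  define R2 where "R2 = sqrt (\<Sum>i\<le>m1. (y2 i)\<^sup>2)"
  have "(\<Sum>i\<le>m0 + m1 + 1. (p i)\<^sup>2) = (\<Sum>i\<le>m0. (y1 i)\<^sup>2) + (\<Sum>i=Suc m0..m0 + m1 + 1. (p i)\<^sup>2)"
  proof -
    have "{..m0 + m1 + 1} = {..m0} \<union> {Suc m0..m0 + m1 + 1}" by auto
    then show ?thesis by (simp add: y1_def sum.union_disjoint)
  qed
  also have "(\<Sum>i=Suc m0..m0 + m1 + 1. (p i)\<^sup>2) = (\<Sum>i\<le>m1. (y2 i)\<^sup>2)"
    unfolding y2_def by (rule sum.reindex_bij_witness[of _ "\<lambda>i. i + Suc m0" "\<lambda>i. i - Suc m0"]) auto
  finally have "R1\<^sup>2 + R2\<^sup>2 = 1" using p' by (simp add: R1_def R2_def sum_nonneg)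
  moreover have "0 \<le> R1" "0 \<le> R2" by (simp_all add: R1_def R2_def sum_nonneg)
  ultimately obtain t where t: "0 \<le> t" "t \<le> pi/2" "R1 = sin t" "R2 = cos t"
    using sincos_total_pi_half[of R2 R1] by (metis add.commute)
  have "\<forall>i>m0. y1 i = 0" by (simp add: y1_def)
  from normalized_block[OF this]
  obtain x1 where x1: "x1 \<in> topspace (nsphere m0)" "\<And>i. y1 i = R1 * x1 i"
    unfolding R1_def by metis
  have "\<forall>i>m1. y2 i = 0" using p' by (simp add: y2_def)
  from normalized_block[OF this]
  obtain x2 where x2: "x2 \<in> topspace (nsphere m1)" "\<And>i. y2 i = R2 * x2 i"
    unfolding R2_def by metis
  have "p i = join_pt m0 (sin t) x1 (cos t) x2 i" for i
    using x1(2)[of i] x2(2)[of "i - Suc m0"] by (auto simp: join_pt_def y1_def y2_def t)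
  then show thesis using that[of t x1 x2] t x1 x2 by auto
qed

text \<open>
  The formula for \<open>H\<close> in terms of \<open>(t, x1, x2)\<close> is visibly continuous, but these are singular coordinates
  on the sphere: \<open>x1\<close> is undetermined at \<open>t = 0\<close> and \<open>x2\<close> at \<open>t = \<pi>/2\<close>. There the conditions \<open>start\<close> and \<open>stop\<close>
  make the formula independent of them. Continuity on the sphere then follows because the parametrisation, a continuous
  map from a compact space onto a Hausdorff space, is a quotient map, also after taking the product with
  the homotopy interval.
\<close>
lemma join_homotopy:
  fixes a b c d :: "real \<Rightarrow> real \<Rightarrow> real"
  assumes cont: "continuous_on ({0..1} \<times> {0..pi/2}) (\<lambda>z. a (fst z) (snd z))"
      "continuous_on ({0..1} \<times> {0..pi/2}) (\<lambda>z. b (fst z) (snd z))"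
      "continuous_on ({0..1} \<times> {0..pi/2}) (\<lambda>z. c (fst z) (snd z))"
      "continuous_on ({0..1} \<times> {0..pi/2}) (\<lambda>z. d (fst z) (snd z))"
    and norm: "\<And>s t. s \<in> {0..1} \<Longrightarrow> t \<in> {0..pi/2} \<Longrightarrow> (a s t)\<^sup>2 + (b s t)\<^sup>2 + (c s t)\<^sup>2 + (d s t)\<^sup>2 = 1"
    and start: "\<And>s. s \<in> {0..1} \<Longrightarrow> a s 0 = 0 \<and> b s 0 = 0"
    and stop: "\<And>s. s \<in> {0..1} \<Longrightarrow> c s (pi/2) = 0 \<and> d s (pi/2) = 0"
    and parity: "(\<forall>s t. b s t = 0) \<or> odd m0" "(\<forall>s t. d s t = 0) \<or> odd m1"
    and f0: "\<And>t x1 x2. t \<in> {0..pi/2} \<Longrightarrow> x1 \<in> topspace (nsphere m0) \<Longrightarrow> x2 \<in> topspace (nsphere m1) \<Longrightarrow>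
       f0 (join_pt m0 (sin t) x1 (cos t) x2) = twisted_join m0 (a 0 t) (b 0 t) x1 (c 0 t) (d 0 t) x2"
    and f1: "\<And>t x1 x2. t \<in> {0..pi/2} \<Longrightarrow> x1 \<in> topspace (nsphere m0) \<Longrightarrow> x2 \<in> topspace (nsphere m1) \<Longrightarrow>
       f1 (join_pt m0 (sin t) x1 (cos t) x2) = twisted_join m0 (a 1 t) (b 1 t) x1 (c 1 t) (d 1 t) x2"
  shows "homotopic_with (\<lambda>x. True) (nsphere (m0 + m1 + 1)) (nsphere (m0 + m1 + 1)) f0 f1"
proof -
  let ?I = "top_of_set {0..1::real}" and ?T = "top_of_set {0..pi/2}"
  let ?S = "nsphere (m0 + m1 + 1)"
  define K where "K = prod_topology ?T (prod_topology (nsphere m0) (nsphere m1))"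
  define q where "q = (\<lambda>(t, x1, x2). join_pt m0 (sin t) x1 (cos t) x2)"
  define G where "G = (\<lambda>(s, t, x1, x2). twisted_join m0 (a s t) (b s t) x1 (c s t) (d s t) x2)"
  define Q where "Q = (\<lambda>(s::real, k). (s, q k))"
  have topK: "topspace K = {0..pi/2} \<times> topspace (nsphere m0) \<times> topspace (nsphere m1)"
    by (simp add: K_def)
  have coord: "continuous_map X euclideanreal (\<lambda>x. f x i)" if "continuous_map X (nsphere m) f"
    for X :: "'a topology" and m f and i :: nat
    using continuous_map_compose[OF that continuous_map_nsphere_projection] by (simp add: o_def)
  have into_S: "continuous_map X ?S f"
    if "\<And>i. continuous_map X euclideanreal (\<lambda>x. f x i)" "\<And>x. x \<in> topspace X \<Longrightarrow> f x \<in> topspace ?S"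
    for X :: "'a topology" and f
    unfolding nsphere
  proof (rule continuous_map_into_subtopology)
    show "continuous_map X (powertop_real UNIV) f"
      using that(1) by (simp add: continuous_map_componentwise_UNIV)
    show "f \<in> topspace X \<rightarrow> {x. (\<Sum>i\<le>m0 + m1 + 1. (x i)\<^sup>2) = 1 \<and> (\<forall>i>m0 + m1 + 1. x i = 0)}"
      using that(2) by (auto simp: topspace_nsphere_iff)
  qed
  have projK: "continuous_map K ?T fst" "continuous_map K (nsphere m0) (\<lambda>k. fst (snd k))"
    "continuous_map K (nsphere m1) (\<lambda>k. snd (snd k))"
    unfolding K_def by (intro continuous_map_fst continuous_map_fst_of[unfolded o_def]
        continuous_map_snd_of[unfolded o_def] continuous_map_snd continuous_map_compose[unfolded o_def, OF continuous_map_snd])+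
  have q_in: "q k \<in> topspace ?S" if "k \<in> topspace K" for k
  proof -
    obtain t x1 x2 where k: "k = (t, x1, x2)" by (cases k)
    show ?thesis
      using that twisted_join_nsphere[of x1 m0 x2 m1 0 0 "sin t" "cos t"]
      by (auto simp: k topK q_def twisted_join_untwisted)
  qed
  have T_fun: "continuous_map K euclideanreal (\<lambda>k. f (fst k))" if "continuous_on {0..pi/2} f" for f
  proof -
    have "continuous_map ?T euclideanreal f" using that by simp
    from continuous_map_compose[OF projK(1) this] show ?thesis by (simp add: o_def)
  qed
  have qcont: "continuous_map K ?S q"
  proof (rule into_S[OF _ q_in])
    fix i
    have "continuous_map K euclideanreal (\<lambda>k. if i \<le> m0 then sin (fst k) * fst (snd k) i
        else cos (fst k) * snd (snd k) (i - Suc m0))"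
      by (cases "i \<le> m0") (auto intro!: continuous_map_real_mult T_fun coord[OF projK(2)] coord[OF projK(3)] continuous_intros)
    then show "continuous_map K euclideanreal (\<lambda>k. q k i)"
      by (simp add: q_def join_pt_def split_def)
  qed
  let ?IK = "prod_topology ?I K"
  have Qquot: "quotient_map ?IK (prod_topology ?I ?S) Q"
  proof (rule continuous_imp_quotient_map)
    show "continuous_map ?IK (prod_topology ?I ?S) Q"
      unfolding Q_def split_def
      by (intro continuous_map_pairedI continuous_map_fst continuous_map_compose[OF continuous_map_snd qcont, unfolded o_def])
    show "compact_space ?IK"
      by (simp add: compact_space_prod_topology K_def compact_space_nsphere compact_space_subtopology)
    show "Hausdorff_space (prod_topology ?I ?S)"
      by (simp add: Hausdorff_space_prod_topology Hausdorff_space_nsphere Hausdorff_space_subtopology)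
    show "Q ` topspace ?IK = topspace (prod_topology ?I ?S)"
    proof
      show "Q ` topspace ?IK \<subseteq> topspace (prod_topology ?I ?S)" using q_in by (auto simp: Q_def)
      show "topspace (prod_topology ?I ?S) \<subseteq> Q ` topspace ?IK"
      proof clarsimp
        fix s :: real and p assume s: "0 \<le> s" "s \<le> 1" and p: "p \<in> topspace (nsphere (Suc (m0 + m1)))"
        then obtain t x1 x2 where "t \<in> {0..pi/2}" "x1 \<in> topspace (nsphere m0)" "x2 \<in> topspace (nsphere m1)"
          "p = join_pt m0 (sin t) x1 (cos t) x2" using join_pt_surj[of p m0 m1] by auto
        then have "(s, p) = Q (s, t, x1, x2)" "(t, x1, x2) \<in> topspace K" by (auto simp: Q_def q_def topK)
        then show "(s, p) \<in> Q ` ({0..1} \<times> topspace K)" using s by auto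
      qed
    qed
  qed
  have G_fibre: "G (s, k) = G (s, k')"
    if "s \<in> {0..1}" "k \<in> topspace K" "k' \<in> topspace K" "q k = q k'" for s k k'
  proof -
    obtain t x1 x2 t' y1 y2 where k: "k = (t, x1, x2)" "k' = (t', y1, y2)" by (cases k, cases k') auto
    have "t = t'" "t = 0 \<or> x1 = y1" "t = pi/2 \<or> x2 = y2"
      using join_pt_eqD[of x1 m0 x2 m1 y1 y2 t t'] that by (auto simp: k topK q_def)
    moreover have "twist (a s t) (b s t) x1 = twist (a s t) (b s t) y1"
      using start[OF that(1)] \<open>t = 0 \<or> x1 = y1\<close> by (elim disjE) (simp_all only: twist_0)
    moreover have "twist (c s t) (d s t) x2 = twist (c s t) (d s t) y2"
      using stop[OF that(1)] \<open>t = pi/2 \<or> x2 = y2\<close> by (elim disjE) (simp_all only: twist_0)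
    ultimately show ?thesis by (simp add: G_def k twisted_join_def)
  qed
  have G_in: "G z \<in> topspace ?S" if "z \<in> topspace ?IK" for z
  proof -
    obtain s t x1 x2 where z: "z = (s, t, x1, x2)" by (cases z)
    show ?thesis
      unfolding z G_def prod.case
      by (rule twisted_join_nsphere) (use that parity norm[of s t] in \<open>auto simp: z topK\<close>)
  qed
  have st: "continuous_map ?IK (top_of_set ({0..1} \<times> {0..pi/2})) (\<lambda>z. (fst z, fst (snd z)))"
    unfolding prod_topology_subtopology_eu[symmetric]
    by (intro continuous_map_pairedI continuous_map_fst
        continuous_map_compose[OF continuous_map_snd projK(1), unfolded o_def])
  have coef: "continuous_map ?IK euclideanreal (\<lambda>z. f (fst z) (fst (snd z)))"
    if "continuous_on ({0..1} \<times> {0..pi/2}) (\<lambda>z. f (fst z) (snd z))" for f :: "real \<Rightarrow> real \<Rightarrow> real"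
  proof -
    have "continuous_map (top_of_set ({0..1} \<times> {0..pi/2})) euclideanreal (\<lambda>z. f (fst z) (snd z))"
      using that by simp
    from continuous_map_compose[OF st this] show ?thesis by (simp add: o_def)
  qed
  have x1c: "continuous_map ?IK euclideanreal (\<lambda>z. fst (snd (snd z)) i)"
    and x2c: "continuous_map ?IK euclideanreal (\<lambda>z. snd (snd (snd z)) i)" for i
    by (rule coord[OF continuous_map_compose[OF continuous_map_snd projK(2), unfolded o_def]],
        rule coord[OF continuous_map_compose[OF continuous_map_snd projK(3), unfolded o_def]])
  have twistc: "continuous_map ?IK euclideanreal (\<lambda>z. twist (u (fst z) (fst (snd z))) (w (fst z) (fst (snd z))) (x z) i)"
    if "continuous_on ({0..1} \<times> {0..pi/2}) (\<lambda>z. u (fst z) (snd z))"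
       "continuous_on ({0..1} \<times> {0..pi/2}) (\<lambda>z. w (fst z) (snd z))"
       "\<And>i. continuous_map ?IK euclideanreal (\<lambda>z. x z i)" for u w :: "real \<Rightarrow> real \<Rightarrow> real" and x i
    unfolding twist_def quarter_turn_def
    by (cases "even i") (auto intro!: continuous_map_add continuous_map_diff continuous_map_real_mult continuous_map_minus coef that)
  have Gcont: "continuous_map ?IK ?S G"
  proof (rule into_S[OF _ G_in])
    fix i
    have "continuous_map ?IK euclideanreal (\<lambda>z. if i \<le> m0
        then twist (a (fst z) (fst (snd z))) (b (fst z) (fst (snd z))) (fst (snd (snd z))) i
        else twist (c (fst z) (fst (snd z))) (d (fst z) (fst (snd z))) (snd (snd (snd z))) (i - Suc m0))"
      using twistc[of a b "\<lambda>z. fst (snd (snd z))" i, OF cont(1,2) x1c]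
        twistc[of c d "\<lambda>z. snd (snd (snd z))" "i - Suc m0", OF cont(3,4) x2c]
      by (cases "i \<le> m0") simp_all
    then show "continuous_map ?IK euclideanreal (\<lambda>z. G z i)"
      by (cases "i \<le> m0") (simp_all add: G_def twisted_join_def join_pt_def split_def)
  qed
  define H where "H = (\<lambda>(s::real, p). G (s, SOME k. k \<in> topspace K \<and> q k = p))"
  have HQ: "H (s, q k) = G (s, k)" if "s \<in> {0..1}" "k \<in> topspace K" for s k
  proof -
    have "(SOME k'. k' \<in> topspace K \<and> q k' = q k) \<in> topspace K \<and> q (SOME k'. k' \<in> topspace K \<and> q k' = q k) = q k"
      by (rule someI[of "\<lambda>k'. k' \<in> topspace K \<and> q k' = q k" k]) (use that in simp)
    then show ?thesis unfolding H_def prod.case by (intro G_fibre) (use that in auto)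
  qed
  have "continuous_map ?IK ?S (H \<circ> Q)"
    by (rule continuous_map_eq[OF Gcont]) (auto simp: Q_def HQ)
  then have Hcont: "continuous_map (prod_topology ?I ?S) ?S H"
    by (rule continuous_compose_quotient_map[OF Qquot])
  have ends: "H (0, p) = f0 p \<and> H (1, p) = f1 p" if p: "p \<in> topspace ?S" for p
  proof -
    obtain t x1 x2 where k: "t \<in> {0..pi/2}" "x1 \<in> topspace (nsphere m0)" "x2 \<in> topspace (nsphere m1)"
      "p = join_pt m0 (sin t) x1 (cos t) x2" using join_pt_surj[OF p] .
    then have "p = q (t, x1, x2)" "(t, x1, x2) \<in> topspace K" by (auto simp: q_def topK)
    then show ?thesis using HQ[of 0 "(t, x1, x2)"] HQ[of 1 "(t, x1, x2)"] f0[OF k(1-3)] f1[OF k(1-3)]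
      by (simp add: G_def q_def)
  qed
  show ?thesis
    using Hcont ends by (subst homotopic_with) auto
qed

section \<open>Unwinding the curve on a 2-sphere\<close>

text \<open>
  \<open>(tilted_x, tilted_y, tilted_z)\<close> is the image of the north pole \<open>(0, 0, 1)\<close> under the rotation by \<open>\<beta>\<close>
  about the axis \<open>(0, cos (\<pi> s / 2), sin (\<pi> s / 2))\<close> followed by the rotation by \<open>\<rho>\<close> about the \<open>y\<close>-axis.
  At \<open>s = 0\<close> the axes coincide and the angles add up; at \<open>s = 1\<close> the first rotation fixes the pole. So, as \<open>s\<close>
  increases, the \<open>\<beta>\<close>-part of the winding disappears.
\<close>
definition tilted_x :: "real \<Rightarrow> real \<Rightarrow> real \<Rightarrow> real" where
  "tilted_x s \<beta> \<rho> = cos (pi * s / 2) * sin \<beta> * cos \<rho>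
     + (cos \<beta> + (sin (pi * s / 2))\<^sup>2 * (1 - cos \<beta>)) * sin \<rho>"

definition tilted_y :: "real \<Rightarrow> real \<Rightarrow> real" where
  "tilted_y s \<beta> = cos (pi * s / 2) * sin (pi * s / 2) * (1 - cos \<beta>)"

definition tilted_z :: "real \<Rightarrow> real \<Rightarrow> real \<Rightarrow> real" where
  "tilted_z s \<beta> \<rho> = - (cos (pi * s / 2) * sin \<beta> * sin \<rho>)
     + (cos \<beta> + (sin (pi * s / 2))\<^sup>2 * (1 - cos \<beta>)) * cos \<rho>"

lemma tilted_norm: "(tilted_x s \<beta> \<rho>)\<^sup>2 + (tilted_y s \<beta>)\<^sup>2 + (tilted_z s \<beta> \<rho>)\<^sup>2 = 1"
proof -
  define A where "A = cos (pi * s / 2)"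
  define B where "B = sin (pi * s / 2)"
  define C where "C = cos \<beta>"
  define k where "k = C + B\<^sup>2 * (1 - C)"
  have AB: "B\<^sup>2 = 1 - A\<^sup>2" by (simp add: A_def B_def sin_squared_eq)
  have sb: "(sin \<beta>)\<^sup>2 = 1 - C\<^sup>2" by (simp add: C_def sin_squared_eq)
  have rotation: "(p * v + q * u)\<^sup>2 + (- (p * u) + q * v)\<^sup>2 = (p\<^sup>2 + q\<^sup>2) * (u\<^sup>2 + v\<^sup>2)"
    for p q u v :: real by (simp add: power2_eq_square algebra_simps)
  have "(A * sin \<beta> * cos \<rho> + k * sin \<rho>)\<^sup>2 + (- (A * sin \<beta> * sin \<rho>) + k * cos \<rho>)\<^sup>2
      = ((A * sin \<beta>)\<^sup>2 + k\<^sup>2) * ((sin \<rho>)\<^sup>2 + (cos \<rho>)\<^sup>2)"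
    by (rule rotation)
  also have "\<dots> = A\<^sup>2 * (1 - C\<^sup>2) + k\<^sup>2" by (simp add: power_mult_distrib sb)
  finally have "(tilted_x s \<beta> \<rho>)\<^sup>2 + (tilted_z s \<beta> \<rho>)\<^sup>2 = A\<^sup>2 * (1 - C\<^sup>2) + k\<^sup>2"
    by (simp add: tilted_x_def tilted_z_def A_def B_def C_def k_def)
  moreover have "(tilted_y s \<beta>)\<^sup>2 = A\<^sup>2 * B\<^sup>2 * (1 - C)\<^sup>2"
    by (simp add: tilted_y_def A_def B_def C_def power_mult_distrib)
  moreover have "A\<^sup>2 * (1 - C\<^sup>2) + k\<^sup>2 + A\<^sup>2 * B\<^sup>2 * (1 - C)\<^sup>2 = 1"
    unfolding k_def AB by (simp add: power2_eq_square algebra_simps)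
  ultimately show ?thesis by simp
qed

lemma tilted_0: "tilted_x 0 \<beta> \<rho> = sin (\<rho> + \<beta>)" "tilted_y 0 \<beta> = 0" "tilted_z 0 \<beta> \<rho> = cos (\<rho> + \<beta>)"
  by (simp_all add: tilted_x_def tilted_y_def tilted_z_def sin_add cos_add)

lemma tilted_1: "tilted_x 1 \<beta> \<rho> = sin \<rho>" "tilted_y 1 \<beta> = 0" "tilted_z 1 \<beta> \<rho> = cos \<rho>"
  by (simp_all add: tilted_x_def tilted_y_def tilted_z_def)

lemma tilted_pole: "tilted_x s 0 0 = 0" "tilted_y s 0 = 0"
  by (simp_all add: tilted_x_def tilted_y_def)

text \<open>
  The rotation by \<open>l \<pi>\<close> keeps the pole in the plane of the pole and the axis, which the quarter turn about
  the \<open>y\<close>-axis takes to the plane of the equator.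
\<close>
lemma tilted_equator: "tilted_z s (2 * of_int l * (pi/2)) (pi/2) = 0"
  using sin_npi_int[of l] by (simp add: tilted_z_def mult.commute)

lemma continuous_on_tilted:
  fixes S :: "(real \<times> real) set"
  assumes "continuous_on S \<beta>" "continuous_on S \<rho>" "continuous_on S \<sigma>"
  shows "continuous_on S (\<lambda>z. tilted_x (\<sigma> z) (\<beta> z) (\<rho> z))"
    "continuous_on S (\<lambda>z. tilted_y (\<sigma> z) (\<beta> z))"
    "continuous_on S (\<lambda>z. tilted_z (\<sigma> z) (\<beta> z) (\<rho> z))"
  unfolding tilted_x_def tilted_y_def tilted_z_def by (auto intro!: continuous_intros assms)

section \<open>The degree of the induced map\<close>

lemma endpoint_ext_at_half_pi:
  assumes "(r \<longlongrightarrow> L) (at_left (pi/2))"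
  shows "endpoint_ext r (pi/2) = L"
proof -
  have "Lim (at_left (pi/2)) r = L" by (rule tendsto_Lim[OF _ assms]) simp
  then show ?thesis using pi_gt_zero by (simp add: endpoint_ext_def del: pi_gt_zero)
qed

lemma continuous_on_endpoint_ext:
  assumes bvp: "bvp_solution m0 m1 r"
  shows "continuous_on {0..pi/2} (endpoint_ext r)"
proof -
  obtain L where L: "(r \<longlongrightarrow> L) (at_left (pi/2))" using bvp by (auto simp: bvp_solution_def)
  have r0: "(r \<longlongrightarrow> 0) (at_right 0)" using bvp by (simp add: bvp_solution_def)
  have pi2: "(0::real) < pi/2" by simp
  have inside: "endpoint_ext r t = r t" if "0 < t" "t < pi/2" for t
    using that by (simp add: endpoint_ext_def)
  have "(endpoint_ext r \<longlongrightarrow> endpoint_ext r x) (at x within {0..pi/2})" if x: "x \<in> {0..pi/2}" for x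
  proof -
    consider "x = 0" | "x = pi/2" | "0 < x" "x < pi/2" using x by fastforce
    then show ?thesis
    proof cases
      case 1
      have "eventually (\<lambda>t. r t = endpoint_ext r t) (at_right 0)"
        using eventually_at_right_real[OF pi2] by eventually_elim (simp add: inside)
      from Lim_transform_eventually[OF r0 this] show ?thesis
        using 1 endpoint_ext_bvp(1)[OF bvp] by (simp add: at_within_Icc_at_right)
    next
      case 2
      have "eventually (\<lambda>t. r t = endpoint_ext r t) (at_left (pi/2))"
        using eventually_at_left_real[OF pi2] by eventually_elim (simp add: inside)
      from Lim_transform_eventually[OF L this] show ?thesis
        unfolding 2 endpoint_ext_at_half_pi[OF L] by (simp add: at_within_Icc_at_left)
    next
      case 3
      have "(r has_real_derivative deriv r x) (at x)"
        using bvp 3 by (simp add: bvp_solution_def ode_solution_def)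
      then have "(r \<longlongrightarrow> r x) (at x)" using DERIV_isCont isCont_def by blast
      moreover have "eventually (\<lambda>t. r t = endpoint_ext r t) (at x)"
        using eventually_at_in_open'[of "{0<..<pi/2}" x] 3 by (auto elim!: eventually_mono simp: inside)
      ultimately have "(endpoint_ext r \<longlongrightarrow> endpoint_ext r x) (at x)"
        unfolding inside[OF 3] by (rule Lim_transform_eventually)
      then show ?thesis by (rule tendsto_within_subset) simp
    qed
  qed
  then show ?thesis by (simp add: continuous_on_def)
qed

text \<open>
  Split the total angle into \<open>\<beta>\<close>, of total amount \<open>l \<pi>\<close>, which is unwound by tilting its axis, and the rest
  \<open>\<rho>\<close>, which ends at \<open>\<pi>/2\<close> and is deformed linearly into \<open>t\<close>. Tilting needs the third dimension given by \<open>J x1\<close>, unless \<open>l = 0\<close>,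
  when \<open>\<beta>\<close> vanishes.
\<close>
lemma psi_homotopic_id:
  fixes l :: int
  assumes bvp: "bvp_solution m0 m1 r" and lim: "(r \<longlongrightarrow> (2 * of_int l + 1) * (pi/2)) (at_left (pi/2))"
    and parity: "odd m0 \<or> l = 0"
  shows "homotopic_with (\<lambda>x. True) (nsphere (m0 + m1 + 1)) (nsphere (m0 + m1 + 1)) (psi m0 m1 r) id"
proof -
  define R where "R = endpoint_ext r"
  define \<beta> where "\<beta> = (\<lambda>t::real. 2 * of_int l * t)"
  define \<rho> where "\<rho> = (\<lambda>s t. (1 - s) * (R t - \<beta> t) + s * t)"
  have R0: "R 0 = 0" using endpoint_ext_bvp(1)[OF bvp] by (simp add: R_def)
  have R1: "R (pi/2) = (2 * of_int l + 1) * (pi/2)" using endpoint_ext_at_half_pi[OF lim] by (simp add: R_def)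
  have Rc: "continuous_on ({0..1::real} \<times> {0..pi/2}) (\<lambda>z. R (snd z))"
    unfolding R_def
    by (rule continuous_on_compose2[OF continuous_on_endpoint_ext[OF bvp]]) (auto intro!: continuous_intros)
  have \<beta>c: "continuous_on ({0..1::real} \<times> {0..pi/2}) (\<lambda>z. \<beta> (snd z))"
    unfolding \<beta>_def by (intro continuous_intros)
  have \<rho>c: "continuous_on ({0..1::real} \<times> {0..pi/2}) (\<lambda>z. \<rho> (fst z) (snd z))"
    unfolding \<rho>_def by (intro continuous_intros Rc \<beta>c)
  have sc: "continuous_on ({0..1::real} \<times> {0..pi/2}) (\<lambda>z. fst z :: real)" by (intro continuous_intros)
  note tc = continuous_on_tilted[OF \<beta>c \<rho>c sc]
  show ?thesis
  proof (rule join_homotopy[where a = "\<lambda>s t. tilted_x s (\<beta> t) (\<rho> s t)" and b = "\<lambda>s t. tilted_y s (\<beta> t)"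
        and c = "\<lambda>s t. tilted_z s (\<beta> t) (\<rho> s t)" and d = "\<lambda>s t. 0"])
    show "(tilted_x s (\<beta> t) (\<rho> s t))\<^sup>2 + (tilted_y s (\<beta> t))\<^sup>2 + (tilted_z s (\<beta> t) (\<rho> s t))\<^sup>2 + 0\<^sup>2 = 1" for s t
      using tilted_norm[of s "\<beta> t" "\<rho> s t"] by simp
    show "tilted_x s (\<beta> 0) (\<rho> s 0) = 0 \<and> tilted_y s (\<beta> 0) = 0" for s
      by (simp add: \<rho>_def R0 \<beta>_def tilted_pole)
    show "tilted_z s (\<beta> (pi/2)) (\<rho> s (pi/2)) = 0 \<and> (0::real) = 0" for s
    proof -
      have \<rho>: "\<rho> s (pi/2) = pi/2" by (simp add: \<rho>_def R1 \<beta>_def algebra_simps)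
      show ?thesis unfolding \<rho> \<beta>_def by (simp only: tilted_equator)
    qed
    show "(\<forall>s t. tilted_y s (\<beta> t) = 0) \<or> odd m0"
      using parity by (auto simp: \<beta>_def tilted_pole)
  qed (use tc in \<open>simp_all add: tilted_0 tilted_1 twisted_join_untwisted psi_join_pt[OF bvp] \<rho>_def R_def\<close>)
qed

text \<open>
  The argument of \<open>psi_homotopic_id\<close> with the two factors of the join exchanged, that is, with time
  reversed. Measured backwards from \<open>t = \<pi>/2\<close>, the curve starts at \<open>x1\<close> or \<open>- x1\<close>; the sign \<open>\<epsilon>\<close> is that of this
  endpoint.
\<close>
lemma psi_homotopic_sign:
  fixes l :: int
  assumes bvp: "bvp_solution m0 m1 r" and lim: "(r \<longlongrightarrow> (2 * of_int l + 1) * (pi/2)) (at_left (pi/2))"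
    and parity: "odd m1"
  shows "homotopic_with (\<lambda>x. True) (nsphere (m0 + m1 + 1)) (nsphere (m0 + m1 + 1)) (psi m0 m1 r)
    (\<lambda>p i. cos (pi * of_int l) * p i)"
proof -
  define \<epsilon> where "\<epsilon> = cos (pi * real_of_int l)"
  have \<epsilon>: "\<epsilon>\<^sup>2 = 1" by (simp add: \<epsilon>_def)
  define R where "R = (\<lambda>t. (2 * of_int l + 1) * (pi/2) - endpoint_ext r t)"
  define \<beta> where "\<beta> = (\<lambda>t::real. 2 * of_int l * (pi/2 - t))"
  define \<rho> where "\<rho> = (\<lambda>s t. (1 - s) * (R t - \<beta> t) + s * (pi/2 - t))"
  have R0: "R 0 = (2 * of_int l + 1) * (pi/2)" using endpoint_ext_bvp(1)[OF bvp] by (simp add: R_def)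
  have R1: "R (pi/2) = 0" using endpoint_ext_at_half_pi[OF lim] by (simp add: R_def)
  have Rc: "continuous_on ({0..1::real} \<times> {0..pi/2}) (\<lambda>z. R (snd z))"
    unfolding R_def
    by (intro continuous_intros continuous_on_compose2[OF continuous_on_endpoint_ext[OF bvp]]) auto
  have \<beta>c: "continuous_on ({0..1::real} \<times> {0..pi/2}) (\<lambda>z. \<beta> (snd z))"
    unfolding \<beta>_def by (intro continuous_intros)
  have \<rho>c: "continuous_on ({0..1::real} \<times> {0..pi/2}) (\<lambda>z. \<rho> (fst z) (snd z))"
    unfolding \<rho>_def by (intro continuous_intros Rc \<beta>c)
  have sc: "continuous_on ({0..1::real} \<times> {0..pi/2}) (\<lambda>z. fst z :: real)" by (intro continuous_intros)
  note tc = continuous_on_tilted[OF \<beta>c \<rho>c sc]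
  have sin_r: "sin (endpoint_ext r t) = \<epsilon> * cos (R t)" and cos_r: "cos (endpoint_ext r t) = \<epsilon> * sin (R t)" for t
  proof -
    have "endpoint_ext r t = pi * of_int l + (pi/2 - R t)" by (simp add: R_def algebra_simps)
    then show "sin (endpoint_ext r t) = \<epsilon> * cos (R t)" "cos (endpoint_ext r t) = \<epsilon> * sin (R t)"
      unfolding \<epsilon>_def by (simp_all only: sin_add cos_add sin_npi_int sin_diff cos_diff) simp_all
  qed
  show ?thesis
    unfolding \<epsilon>_def[symmetric]
  proof (rule join_homotopy[where a = "\<lambda>s t. \<epsilon> * tilted_z s (\<beta> t) (\<rho> s t)" and b = "\<lambda>s t. 0"
        and c = "\<lambda>s t. \<epsilon> * tilted_x s (\<beta> t) (\<rho> s t)" and d = "\<lambda>s t. \<epsilon> * tilted_y s (\<beta> t)"])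
    show "(\<epsilon> * tilted_z s (\<beta> t) (\<rho> s t))\<^sup>2 + 0\<^sup>2 + (\<epsilon> * tilted_x s (\<beta> t) (\<rho> s t))\<^sup>2 + (\<epsilon> * tilted_y s (\<beta> t))\<^sup>2 = 1" for s t
      using tilted_norm[of s "\<beta> t" "\<rho> s t"] by (simp add: power_mult_distrib \<epsilon>)
    show "\<epsilon> * tilted_x s (\<beta> (pi/2)) (\<rho> s (pi/2)) = 0 \<and> \<epsilon> * tilted_y s (\<beta> (pi/2)) = 0" for s
      by (simp add: \<rho>_def R1 \<beta>_def tilted_pole)
    show "\<epsilon> * tilted_z s (\<beta> 0) (\<rho> s 0) = 0 \<and> (0::real) = 0" for s
    proof -
      have \<rho>: "\<rho> s 0 = pi/2" by (simp add: \<rho>_def R0 \<beta>_def algebra_simps)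
      show ?thesis unfolding \<rho> \<beta>_def diff_zero by (simp only: tilted_equator mult_zero_right)
    qed
    show "(\<lambda>i. \<epsilon> * join_pt m0 (sin t) x1 (cos t) x2 i)
        = twisted_join m0 (\<epsilon> * tilted_z 1 (\<beta> t) (\<rho> 1 t)) 0 x1 (\<epsilon> * tilted_x 1 (\<beta> t) (\<rho> 1 t)) (\<epsilon> * tilted_y 1 (\<beta> t)) x2"
      for t x1 x2
      by (auto simp: tilted_1 twisted_join_untwisted \<rho>_def join_pt_def cos_diff sin_diff)
  qed (use tc parity in \<open>auto simp: tilted_0 twisted_join_untwisted psi_join_pt[OF bvp] \<rho>_def sin_r cos_r
        intro!: continuous_intros\<close>)
qed

lemma degree_psi_odd:
  assumes bvp: "bvp_solution m0 m1 r" and parity: "odd m0 \<or> odd m1"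
  shows "Brouwer_degree2 (m0 + m1 + 1) (psi m0 m1 r) \<in> {1, -1}"
proof -
  obtain l :: int where l: "(r \<longlongrightarrow> (2 * of_int l + 1) * (pi/2)) (at_left (pi/2))"
    using bvp by (auto simp: bvp_solution_def)
  show ?thesis
  proof (cases "odd m0")
    case True
    then show ?thesis using Brouwer_degree2_homotopic[OF psi_homotopic_id[OF bvp l]] by simp
  next
    case False
    define e where "e = (\<lambda>(p :: nat \<Rightarrow> real) i. cos (pi * of_int l) * p i)"
    let ?S = "nsphere (m0 + m1 + 1)"
    have hom: "homotopic_with (\<lambda>x. True) ?S ?S (psi m0 m1 r) e"
      unfolding e_def using psi_homotopic_sign[OF bvp l] parity False by blast
    then have cont: "continuous_map ?S ?S e"
      by (blast dest: homotopic_with_imp_continuous_maps)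
    have "e \<circ> e = id" by (simp add: fun_eq_iff e_def)
    then have "Brouwer_degree2 (m0 + m1 + 1) e * Brouwer_degree2 (m0 + m1 + 1) e = 1"
      using Brouwer_degree2_compose[OF cont cont] by (simp only: Brouwer_degree2_id)
    then show ?thesis
      using Brouwer_degree2_homotopic[OF hom] by (auto simp: zmult_eq_1_iff)
  qed
qed

theorem theoremF:
  fixes m0 m1 :: nat
  assumes "m0 \<ge> 1" and "m1 \<ge> 1"
  shows "\<exists>v0::real. \<forall>(r :: real \<Rightarrow> real) (v::real).
           bvp_solution m0 m1 r \<longrightarrow> has_initial_velocity r v \<longrightarrow> v \<ge> v0 \<longrightarrow>
           Brouwer_degree2 (m0 + m1 + 1) (psi m0 m1 r) \<in> {1, -1}"
proof (cases "odd m0 \<or> odd m1")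
  case True
  then show ?thesis using degree_psi_odd by blast
next
  case False
  then have m: "2 \<le> m0" "2 \<le> m1" using assms by presburger+
  obtain v0 where v0: "\<And>r v (l::int). bvp_solution m0 m1 r \<Longrightarrow> has_initial_velocity r v \<Longrightarrow> v0 \<le> v \<Longrightarrow>
     (r \<longlongrightarrow> (2 * of_int l + 1) * (pi/2)) (at_left (pi/2)) \<Longrightarrow> l = 0"
    using fast_solution_ends_at_half_pi[OF m] by blast
  have "Brouwer_degree2 (m0 + m1 + 1) (psi m0 m1 r) = 1"
    if bvp: "bvp_solution m0 m1 r" and vel: "has_initial_velocity r v" and v: "v0 \<le> v" for r v
  proof -
    obtain l :: int where l: "(r \<longlongrightarrow> (2 * of_int l + 1) * (pi/2)) (at_left (pi/2))"
      using bvp by (auto simp: bvp_solution_def)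
    then have "l = 0" by (rule v0[OF bvp vel v])
    then show ?thesis using Brouwer_degree2_homotopic[OF psi_homotopic_id[OF bvp l]] by simp
  qed
  then show ?thesis by blast
qed

end
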